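(* Let $\mathbf{\Sigma}$ be a nice topological pointclass, and assume that $\mathsf{Det}(\mathbf{\Sigma}(\omega^\omega))$ holds. Let $Z$ be an uncountable zero-dimensional Polish space. If $\mathbf{\Gamma}\in\mathsf{NSD}_{\mathbf{\Sigma}}(Z)$ then exactly one of $\mathbf{\Gamma}$ and $\check{\mathbf{\Gamma}}$ has the separation property.
   Context: Work in $\mathsf{ZF}+\mathsf{DC}$. "Space" means separable metrizable topological space. A space is zero-dimensional if it is non-empty and has a base of clopen sets. Determinacy: a set $S\subseteq\omega^\omega$ is determined if one of the players has a winning strategy in the game where I and II alternately play $x_0,y_0,x_1,y_1,\ldots\in\omega$ and I wins iff $(x_0,y_0,x_1,y_1,\ldots)\in S$. $\mathsf{Det}(\mathcal{S})$ means every element of $\mathcal{S}\subseteq\mathcal{P}(\omega^\omega)$ is determined. Pointclasses: a topological pointclass is a function $\mathbf{\Sigma}$ assigning to each space $Z$ a collection $\mathbf{\Sigma}(Z)\subseteq\mathcal{P}(Z)$ such that $f^{-1}[B]\in\mathbf{\Sigma}(Z)$ whenever $f:Z\to W$ is continuous and $B\in\mathbf{\Sigma}(W)$. A Borel space is a space homeomorphic to a Borel subset of a Polish space. $\mathbf{\Sigma}$ is nice if moreover, for every space $Z$: every Borel subset of $Z$ is in $\mathbf{\Sigma}(Z)$; $\mathbf{\Sigma}(Z)$ is a Boolean subalgebra of $\mathcal{P}(Z)$; $f^{-1}[B]\in\mathbf{\Sigma}(Z)$ whenever $f:Z\to W$ is a Borel function and $B\in\mathbf{\Sigma}(W)$;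 and if $j[Z]\in\mathbf{\Sigma}(W)$ for some Borel space $W$ and embedding $j:Z\to W$, then $i[Z]\in\mathbf{\Sigma}(W)$ for every Borel space $W$ and embedding $i:Z\to W$. Wadge classes: for $\mathbf{\Gamma}\subseteq\mathcal{P}(Z)$, the dual is $\check{\mathbf{\Gamma}}=\{Z\setminus A:A\in\mathbf{\Gamma}\}$; $\mathbf{\Gamma}$ is selfdual if $\mathbf{\Gamma}=\check{\mathbf{\Gamma}}$; $\Delta(\mathbf{\Gamma})=\mathbf{\Gamma}\cap\check{\mathbf{\Gamma}}$. A Wadge class in $Z$ is a collection of the form $\{f^{-1}[A]:f:Z\to Z\text{ continuous}\}$ for some $A\subseteq Z$. $\mathsf{NSD}(Z)$ is the set of all non-selfdual Wadge classes in $Z$, and $\mathsf{NSD}_{\mathbf{\Sigma}}(Z)=\{\mathbf{\Gamma}\in\mathsf{NSD}(Z):\mathbf{\Gamma}\subseteq\mathbf{\Sigma}(Z)\}$. Separation: $\mathbf{\Gamma}\subseteq\mathcal{P}(Z)$ has the separation property if for all disjoint $A,B\in\mathbf{\Gamma}$ there is $C\in\Delta(\mathbf{\Gamma})$ with $A\subseteq C\subseteq Z\setminus B$. *)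

theory Defs
  imports "HOL-Analysis.Analysis"
begin

section \<open>Spaces\<close>

definition sep_metrizable_space :: "'a topology \<Rightarrow> bool" where
  "sep_metrizable_space X \<longleftrightarrow> separable_space X \<and> metrizable_space X"

definition zero_dimensional_space :: "'a topology \<Rightarrow> bool" where
  "zero_dimensional_space X \<longleftrightarrow>
     sep_metrizable_space X \<and> topspace X \<noteq> {} \<and>
     (\<exists>\<B>. (\<forall>V\<in>\<B>. openin X V \<and> closedin X V) \<and>
          (\<forall>U x. openin X U \<and> x \<in> U \<longrightarrow> (\<exists>V\<in>\<B>. x \<in> V \<and> V \<subseteq> U)))"

definition polish_topology :: "'a topology \<Rightarrow> bool" where
  "polish_topology X \<longleftrightarrow> separable_space X \<and> completely_metrizable_space X"

definition borel_sets_of :: "'a topology \<Rightarrow> 'a set set" where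
  "borel_sets_of X = sigma_sets (topspace X) {U. openin X U}"

definition preimage_in :: "'a topology \<Rightarrow> ('a \<Rightarrow> 'b) \<Rightarrow> 'b set \<Rightarrow> 'a set" where
  "preimage_in X f B = {x \<in> topspace X. f x \<in> B}"

definition borel_map :: "'a topology \<Rightarrow> 'b topology \<Rightarrow> ('a \<Rightarrow> 'b) \<Rightarrow> bool" where
  "borel_map X Y f \<longleftrightarrow>
     f \<in> topspace X \<rightarrow> topspace Y \<and>
     (\<forall>U. openin Y U \<longrightarrow> preimage_in X f U \<in> borel_sets_of X)"

text \<open>
  A separable metrizable space has at most continuum many points, so it has a homeomorphic
  copy whose points are elements of \<^typ>\<open>nat \<Rightarrow> nat\<close> (this is proved below).  The topologies on
  subsets of that type therefore represent all spaces up to homeomorphism. They include the Baire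
  space itself: \<^term>\<open>euclidean :: (nat \<Rightarrow> nat) topology\<close> is the product of the discrete topologies.
\<close>

type_synonym small_space = "(nat \<Rightarrow> nat) topology"

abbreviation baire_space :: small_space where
  "baire_space \<equiv> euclidean"

definition borel_space :: "'a topology \<Rightarrow> bool" where
  "borel_space X \<longleftrightarrow>
     (\<exists>(P :: small_space) B. polish_topology P \<and> B \<in> borel_sets_of P \<and>
        X homeomorphic_space subtopology P B)"

section \<open>Games\<close>

text \<open>
  A run \<open>z\<close> lists the moves of both players, player I moving at even and player II at odd stages.
  A strategy maps the finite sequence of all moves made so far to the next move.
\<close>

definition winning_for_I :: "(nat \<Rightarrow> nat) set \<Rightarrow> (nat list \<Rightarrow> nat) \<Rightarrow> bool" where
  "winning_for_I S \<sigma> \<longleftrightarrow>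
     (\<forall>z. (\<forall>n. z (2 * n) = \<sigma> (map z [0..<2 * n])) \<longrightarrow> z \<in> S)"

definition winning_for_II :: "(nat \<Rightarrow> nat) set \<Rightarrow> (nat list \<Rightarrow> nat) \<Rightarrow> bool" where
  "winning_for_II S \<tau> \<longleftrightarrow>
     (\<forall>z. (\<forall>n. z (2 * n + 1) = \<tau> (map z [0..<2 * n + 1])) \<longrightarrow> z \<notin> S)"

definition determined :: "(nat \<Rightarrow> nat) set \<Rightarrow> bool" where
  "determined S \<longleftrightarrow> (\<exists>\<sigma>. winning_for_I S \<sigma>) \<or> (\<exists>\<tau>. winning_for_II S \<tau>)"

definition Det :: "(nat \<Rightarrow> nat) set set \<Rightarrow> bool" where
  "Det \<S> \<longleftrightarrow> (\<forall>S\<in>\<S>. determined S)"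

section \<open>Pointclasses\<close>

text \<open>
  A pointclass is given by its values on the spaces whose points lie in \<^typ>\<open>nat \<Rightarrow> nat\<close>;
  \<open>pointclass_at\<close> extends it to spaces on other types.  Closure under continuous preimages
  makes a pointclass invariant under homeomorphisms, so this is the only possible extension.
  Values at topologies that are not separable metrizable are irrelevant.
\<close>

type_synonym pointclass = "small_space \<Rightarrow> (nat \<Rightarrow> nat) set set"

definition topological_pointclass :: "pointclass \<Rightarrow> bool" where
  "topological_pointclass \<Sigma> \<longleftrightarrow>
     (\<forall>Z. sep_metrizable_space Z \<longrightarrow> \<Sigma> Z \<subseteq> Pow (topspace Z)) \<and>
     (\<forall>Z W f B. sep_metrizable_space Z \<and> sep_metrizable_space W \<and>
        continuous_map Z W f \<and> B \<in> \<Sigma> W \<longrightarrow> preimage_in Z f B \<in> \<Sigma> Z)"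

definition nice_pointclass :: "pointclass \<Rightarrow> bool" where
  "nice_pointclass \<Sigma> \<longleftrightarrow>
     topological_pointclass \<Sigma> \<and>
     (\<forall>Z. sep_metrizable_space Z \<longrightarrow> borel_sets_of Z \<subseteq> \<Sigma> Z) \<and>
     (\<forall>Z. sep_metrizable_space Z \<longrightarrow> algebra (topspace Z) (\<Sigma> Z)) \<and>
     (\<forall>Z W f B. sep_metrizable_space Z \<and> sep_metrizable_space W \<and>
        borel_map Z W f \<and> B \<in> \<Sigma> W \<longrightarrow> preimage_in Z f B \<in> \<Sigma> Z) \<and>
     (\<forall>Z :: small_space. sep_metrizable_space Z \<longrightarrow>
        (\<exists>W j. borel_space W \<and> embedding_map Z W j \<and> j ` topspace Z \<in> \<Sigma> W) \<longrightarrow>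
        (\<forall>W i. borel_space W \<and> embedding_map Z W i \<longrightarrow> i ` topspace Z \<in> \<Sigma> W))"

definition pointclass_at :: "pointclass \<Rightarrow> 'a topology \<Rightarrow> 'a set set" where
  "pointclass_at \<Sigma> Z =
     {A. A \<subseteq> topspace Z \<and> (\<exists>(W :: small_space) h. homeomorphic_map Z W h \<and> h ` A \<in> \<Sigma> W)}"

lemma homeomorphic_map_sep_metrizable:
  assumes "homeomorphic_map X Y h"
  shows "sep_metrizable_space X \<longleftrightarrow> sep_metrizable_space Y"
  using assms homeomorphic_map_imp_homeomorphic_space homeomorphic_metrizable_space
    homeomorphic_separable_space unfolding sep_metrizable_space_def by blast

text \<open>Every separable metrizable space has a representative on \<^typ>\<open>nat \<Rightarrow> nat\<close>.\<close>

lemma ex_small_copy: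
  fixes X :: "'a topology"
  assumes "sep_metrizable_space X"
  shows "\<exists>(W :: small_space) h. homeomorphic_map X W h"
proof -
  from assms obtain M d where M: "Metric_space M d" and X: "X = Metric_space.mtopology M d"
    unfolding sep_metrizable_space_def metrizable_space_def by blast
  interpret Metric_space M d by (fact M)
  have top: "topspace X = M" using X by simp
  obtain C where C: "countable C" "C \<subseteq> M" "X closure_of C = M"
    using assms top unfolding sep_metrizable_space_def separable_space_def by auto
  define c where "c = from_nat_into C"
  define e :: "'a \<Rightarrow> nat \<Rightarrow> nat" where
    "e x n = (if d x (c (fst (prod_decode n))) < 1 / real (Suc (snd (prod_decode n))) then 1 else 0)" for x n
  have inj: "inj_on e M"
  proof (rule inj_onI, rule ccontr)
    fix x y assume xy: "x \<in> M" "y \<in> M" "e x = e y" "x \<noteq> y"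
    then have "0 < d x y / 2" by (simp add: mdist_pos_less)
    then obtain k where k: "1 / real (Suc k) < d x y / 2"
      using nat_approx_posE by blast
    have "\<exists>z\<in>C. z \<in> mball x (1 / real (Suc k))"
    proof -
      have "x \<in> mtopology closure_of C" using C(3) xy(1) X by simp
      then have *: "\<And>r. 0 < r \<Longrightarrow> \<exists>y\<in>C. y \<in> mball x r"
        unfolding metric_closure_of by simp
      show ?thesis by (rule *) simp
    qed
    then obtain z where z: "z \<in> C" "d x z < 1 / real (Suc k)" "z \<in> M" by auto
    obtain m where m: "c m = z"
      using from_nat_into_surj[OF C(1) z(1)] unfolding c_def by (elim exE)
    have "e x (prod_encode (m, k)) = 1" using z m by (simp add: e_def)
    then have "e y (prod_encode (m, k)) = 1" using xy(3) by simp
    then have "d y z < 1 / real (Suc k)" using m by (simp add: e_def split: if_splits)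
    moreover have "d x y \<le> d x z + d y z"
      using triangle[OF xy(1) z(3) xy(2)] by (simp add: commute)
    ultimately show False using k z(2) by linarith
  qed
  define g where "g = inv_into M e"
  define W where "W = pullback_topology (e ` M) g X"
  have g: "g (e x) = x" if "x \<in> M" for x
    using that inj by (simp add: g_def)
  have topW: "topspace W = e ` M"
    unfolding W_def topspace_pullback_topology using g top by auto
  have "homeomorphic_maps X W e g"
    unfolding homeomorphic_maps_def
  proof (intro conjI)
    show "continuous_map X W e"
      unfolding W_def
    proof (rule continuous_map_pullback')
      show "continuous_map X X (g \<circ> e)"
        by (rule continuous_map_eq[OF continuous_map_id]) (simp add: g top)
    qed (use top in auto)
    show "continuous_map W X g"
      unfolding W_def using continuous_map_pullback[OF continuous_map_id, of "e ` M" g X] by simp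
  qed (use g top topW in auto)
  then show ?thesis using homeomorphic_maps_map by blast
qed

text \<open>Membership in \<open>pointclass_at\<close> does not depend on the representative.\<close>

lemma pointclass_at_iff:
  fixes Z :: "'a topology" and W :: small_space
  assumes "topological_pointclass \<Sigma>" "sep_metrizable_space Z" "homeomorphic_map Z W h"
  shows "A \<in> pointclass_at \<Sigma> Z \<longleftrightarrow> A \<subseteq> topspace Z \<and> h ` A \<in> \<Sigma> W"
proof
  assume "A \<in> pointclass_at \<Sigma> Z"
  then obtain V :: small_space and k where A: "A \<subseteq> topspace Z" and
    k: "homeomorphic_map Z V k" "k ` A \<in> \<Sigma> V"
    unfolding pointclass_at_def by auto
  obtain h' where h': "homeomorphic_maps Z W h h'"
    using assms(3) homeomorphic_map_maps by blast
  have cont: "continuous_map W V (k \<circ> h')"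
    using h' k(1) continuous_map_compose homeomorphic_imp_continuous_map
    unfolding homeomorphic_maps_def by blast
  have "preimage_in W (k \<circ> h') (k ` A) \<in> \<Sigma> W"
    using assms(1) cont k(2) homeomorphic_map_sep_metrizable[OF assms(3)]
      homeomorphic_map_sep_metrizable[OF k(1)] assms(2)
    unfolding topological_pointclass_def by blast
  moreover have "preimage_in W (k \<circ> h') (k ` A) = h ` A"
  proof -
    have inj: "inj_on k (topspace Z)" using k(1) homeomorphic_imp_injective_map by blast
    have h'Z: "h' y \<in> topspace Z" if "y \<in> topspace W" for y
      using h' that unfolding homeomorphic_maps_def continuous_map_def by auto
    have hW: "h x \<in> topspace W" if "x \<in> topspace Z" for x
      using h' that unfolding homeomorphic_maps_def continuous_map_def by auto
    have inv: "\<And>x. x \<in> topspace Z \<Longrightarrow> h' (h x) = x" "\<And>y. y \<in> topspace W \<Longrightarrow> h (h' y) = y"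
      using h' unfolding homeomorphic_maps_def by auto
    show ?thesis
    proof (intro equalityI subsetI)
      fix y assume "y \<in> preimage_in W (k \<circ> h') (k ` A)"
      then have y: "y \<in> topspace W" "k (h' y) \<in> k ` A" by (auto simp: preimage_in_def)
      then have "h' y \<in> A" using inj A h'Z by (meson inj_on_image_mem_iff)
      then show "y \<in> h ` A" using inv(2)[OF y(1)] by force
    next
      fix y assume "y \<in> h ` A"
      then show "y \<in> preimage_in W (k \<circ> h') (k ` A)"
        using A hW inv(1) by (auto simp: preimage_in_def subset_iff)
    qed
  qed
  ultimately show "A \<subseteq> topspace Z \<and> h ` A \<in> \<Sigma> W" using A by simp
next
  assume "A \<subseteq> topspace Z \<and> h ` A \<in> \<Sigma> W"
  then show "A \<in> pointclass_at \<Sigma> Z" using assms(3) unfolding pointclass_at_def by blast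
qed

lemma pointclass_at_small:
  assumes "topological_pointclass \<Sigma>" "sep_metrizable_space Z"
  shows "pointclass_at \<Sigma> Z = \<Sigma> Z"
proof -
  have "homeomorphic_map Z Z id" by simp
  note iff = pointclass_at_iff[OF assms this]
  have "\<Sigma> Z \<subseteq> Pow (topspace Z)"
    using assms unfolding topological_pointclass_def by blast
  then show ?thesis by (intro set_eqI) (auto simp: iff)
qed

section \<open>Wadge classes and separation\<close>

definition dual_class :: "'a topology \<Rightarrow> 'a set set \<Rightarrow> 'a set set" where
  "dual_class Z \<Gamma> = {topspace Z - A |A. A \<in> \<Gamma>}"

definition selfdual :: "'a topology \<Rightarrow> 'a set set \<Rightarrow> bool" where
  "selfdual Z \<Gamma> \<longleftrightarrow> \<Gamma> = dual_class Z \<Gamma>"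

definition ambiguous_class :: "'a topology \<Rightarrow> 'a set set \<Rightarrow> 'a set set" where
  "ambiguous_class Z \<Gamma> = \<Gamma> \<inter> dual_class Z \<Gamma>"

definition wadge_class :: "'a topology \<Rightarrow> 'a set set \<Rightarrow> bool" where
  "wadge_class Z \<Gamma> \<longleftrightarrow>
     (\<exists>A \<subseteq> topspace Z. \<Gamma> = {preimage_in Z f A |f. continuous_map Z Z f})"

definition NSD :: "'a topology \<Rightarrow> 'a set set set" where
  "NSD Z = {\<Gamma>. wadge_class Z \<Gamma> \<and> \<not> selfdual Z \<Gamma>}"

definition NSD_in :: "pointclass \<Rightarrow> 'a topology \<Rightarrow> 'a set set set" where
  "NSD_in \<Sigma> Z = {\<Gamma> \<in> NSD Z. \<Gamma> \<subseteq> pointclass_at \<Sigma> Z}"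

definition separation_property :: "'a topology \<Rightarrow> 'a set set \<Rightarrow> bool" where
  "separation_property Z \<Gamma> \<longleftrightarrow>
     (\<forall>A\<in>\<Gamma>. \<forall>B\<in>\<Gamma>. A \<inter> B = {} \<longrightarrow>
        (\<exists>C\<in>ambiguous_class Z \<Gamma>. A \<subseteq> C \<and> C \<subseteq> topspace Z - B))"

end

theory Submission
  imports Defs "HOL-Library.Omega_Words_Fun"
begin

text \<open>
  Call a disjoint pair separable if some set in \<open>\<Delta>(\<Gamma>)\<close> separates it.  The space \<open>Z\<close> is a retract of
  the Baire space, so a game of Wadge type with payoff in \<open>\<Sigma>\<close> yields continuous maps of \<open>Z\<close>.
  Both halves of the theorem rest on one consequence of the Martin--Monk method: if \<open>P\<close>, \<open>Q\<close>, \<open>N\<close> are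
  disjoint, then a continuous map exchanges \<open>P\<close> and \<open>Q\<close> and takes values in \<open>P \<union> Q \<union> N\<close> only, or
  one maps \<open>P\<close> into \<open>P\<close> and \<open>Q\<close> into \<open>Q\<close> and avoids \<open>N\<close>.

  If \<open>A\<^sub>0\<close>, \<open>A\<^sub>1\<close> in \<open>\<Gamma>\<close> and \<open>B\<^sub>0\<close>, \<open>B\<^sub>1\<close> in the dual class are two inseparable disjoint pairs, then
  a game reduces the first pair to the second, so we may assume \<open>A\<^sub>0 \<subseteq> B\<^sub>0\<close> and \<open>A\<^sub>1 \<subseteq> B\<^sub>1\<close>.  Apply the
  alternative to \<open>A\<^sub>0\<close>, \<open>B\<^sub>1\<close> and \<open>B\<^sub>0 - A\<^sub>0\<close>.  The preimages of \<open>B\<^sub>0\<close> and \<open>B\<^sub>1\<close> partition \<open>Z\<close> in the first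
  case, and the preimages of \<open>A\<^sub>0\<close> and \<open>B\<^sub>0\<close> agree in the second.  Either way a set in \<open>\<Delta>(\<Gamma>)\<close>
  separates \<open>A\<^sub>0\<close> from \<open>B\<^sub>1\<close>, hence from \<open>A\<^sub>1\<close>.

  For the other half, a diagonal argument gives \<open>V\<^sub>0\<close>, \<open>V\<^sub>1\<close> in \<open>\<Gamma>\<close> with \<open>V\<^sub>0 - V\<^sub>1\<close> and \<open>V\<^sub>1 - V\<^sub>0\<close>
  inseparable.  Apply the alternative to these two sets and the complement of \<open>V\<^sub>0 \<union> V\<^sub>1\<close>.  The
  preimages of \<open>V\<^sub>0\<close> and \<open>V\<^sub>1\<close> are disjoint in the first case, and so are those of their complements
  in the second; the separation property of \<open>\<Gamma>\<close> or of its dual class is contradicted.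
\<close>

section \<open>Sequences of natural numbers\<close>

lemma ex_sequence_by_recursion:
  fixes F :: "'a list \<Rightarrow> 'a"
  shows "\<exists>z. \<forall>n. z n = F (map z [0..<n])"
proof -
  define L where "L = rec_nat [] (\<lambda>_ l. l @ [F l])"
  define z where "z n = F (L n)" for n
  have "map z [0..<n] = L n" for n
    by (induction n) (simp_all add: L_def z_def)
  then show ?thesis using z_def by metis
qed

lemma open_imp_cylinder:
  fixes x :: "nat \<Rightarrow> nat"
  assumes "open U" "x \<in> U"
  shows "\<exists>k. \<forall>y. (\<forall>i<k. y i = x i) \<longrightarrow> y \<in> U"
proof -
  have "openin (product_topology (\<lambda>i. euclidean) UNIV) U"
    using assms(1) unfolding open_fun_def .
  from product_topology_open_contains_basis[OF this assms(2)]
  obtain X :: "nat \<Rightarrow> nat set" where X: "x \<in> Pi\<^sub>E UNIV X" "finite {i. X i \<noteq> UNIV}"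
      "Pi\<^sub>E UNIV X \<subseteq> U" by auto
  obtain k where k: "\<forall>i\<in>{i. X i \<noteq> UNIV}. i < k"
    using X(2) finite_nat_set_iff_bounded by blast
  have "y \<in> U" if y: "\<forall>i<k. y i = x i" for y
  proof -
    have "y i \<in> X i" for i
    proof (cases "X i = UNIV")
      case False
      then have "i < k" using k by blast
      then show ?thesis using y X(1) by (auto simp: PiE_iff)
    qed simp
    then show ?thesis using X(3) by (auto simp: PiE_iff)
  qed
  then show ?thesis by blast
qed

lemma open_cylinder:
  fixes x :: "nat \<Rightarrow> nat"
  shows "open {y. \<forall>i<k. y i = x i}"
proof -
  have eq: "{y. \<forall>i<k. y i = x i} = (\<Inter>i\<in>{..<k}. (\<lambda>y. y i) -` {x i})" by auto
  show ?thesis unfolding eq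
    by (intro open_INT ballI open_vimage) (auto simp: open_discrete)
qed

lemma open_iff_cylinder:
  fixes U :: "(nat \<Rightarrow> nat) set"
  shows "open U \<longleftrightarrow> (\<forall>x\<in>U. \<exists>k. \<forall>y. (\<forall>i<k. y i = x i) \<longrightarrow> y \<in> U)"
proof
  assume R: "\<forall>x\<in>U. \<exists>k. \<forall>y. (\<forall>i<k. y i = x i) \<longrightarrow> y \<in> U"
  show "open U"
  proof (subst open_subopen, intro ballI)
    fix x assume "x \<in> U"
    with R obtain k where k: "\<forall>y. (\<forall>i<k. y i = x i) \<longrightarrow> y \<in> U" by blast
    show "\<exists>T. open T \<and> x \<in> T \<and> T \<subseteq> U"
      by (rule exI[of _ "{y. \<forall>i<k. y i = x i}"]) (use k open_cylinder in auto)
  qed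
qed (use open_imp_cylinder in blast)

lemma continuous_on_sequencesI:
  fixes f :: "(nat \<Rightarrow> nat) \<Rightarrow> nat \<Rightarrow> nat"
  assumes "\<And>x n. \<exists>k. \<forall>y. (\<forall>i<k. y i = x i) \<longrightarrow> f y n = f x n"
  shows "continuous_on UNIV f"
proof (rule continuous_on_coordinatewise_then_product)
  fix n
  have "open ((\<lambda>x. f x n) -` B)" for B
  proof (subst open_iff_cylinder, intro ballI)
    fix x assume x: "x \<in> (\<lambda>x. f x n) -` B"
    obtain k where "\<forall>y. (\<forall>i<k. y i = x i) \<longrightarrow> f y n = f x n" using assms by blast
    then have "\<forall>y. (\<forall>i<k. y i = x i) \<longrightarrow> y \<in> (\<lambda>x. f x n) -` B"
      using x by (metis vimage_eq)
    then show "\<exists>k. \<forall>y. (\<forall>i<k. y i = x i) \<longrightarrow> y \<in> (\<lambda>x. f x n) -` B" ..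
  qed
  then show "continuous_on UNIV (\<lambda>x. f x n)"
    unfolding continuous_on_open_vimage[OF open_UNIV] Int_UNIV_right by blast
qed

text \<open>This notion and the next come from strategies: player I fixes digit \<open>n\<close> of
  his sequence before seeing digit \<open>n\<close> of the other one, player II only
  afterwards.\<close>

definition contraction :: "((nat \<Rightarrow> nat) \<Rightarrow> nat \<Rightarrow> nat) \<Rightarrow> bool" where
  "contraction g \<longleftrightarrow> (\<forall>n x y. (\<forall>i<n. x i = y i) \<longrightarrow> g x n = g y n)"

definition nonexpansive :: "((nat \<Rightarrow> nat) \<Rightarrow> nat \<Rightarrow> nat) \<Rightarrow> bool" where
  "nonexpansive f \<longleftrightarrow> (\<forall>n x y. (\<forall>i\<le>n. x i = y i) \<longrightarrow> f x n = f y n)"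

lemma contractionD: "contraction g \<Longrightarrow> (\<And>i. i < n \<Longrightarrow> x i = y i) \<Longrightarrow> g x n = g y n"
  unfolding contraction_def by simp

lemma contraction_imp_nonexpansive: "contraction g \<Longrightarrow> nonexpansive g"
  unfolding nonexpansive_def by (intro allI impI, erule contractionD) simp

lemma nonexpansive_imp_continuous:
  assumes "nonexpansive f"
  shows "continuous_on UNIV f"
proof (rule continuous_on_sequencesI)
  fix x n
  show "\<exists>k. \<forall>y. (\<forall>i<k. y i = x i) \<longrightarrow> f y n = f x n"
    using assms unfolding nonexpansive_def by (intro exI[of _ "Suc n"]) (auto simp: less_Suc_eq_le)
qed

lemmas contraction_imp_continuous = nonexpansive_imp_continuous[OF contraction_imp_nonexpansive]

text \<open>
  The infinite composition \<open>G (z 0) \<circ> G (z 1) \<circ> G (z 2) \<circ> \<dots>\<close> converges because every factor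
  determines one more digit.
\<close>

lemma ex_infinite_composition:
  assumes "\<And>a. contraction (G a)"
  obtains X where "continuous_on UNIV X" "\<And>z :: nat \<Rightarrow> nat. X z = G (z 0) (X (suffix 1 z))"
proof -
  \<comment> \<open>\<open>D k z\<close> applies the first \<open>k\<close> factors to the zero
    sequence. Digit \<open>i\<close> depends neither on that start nor on \<open>k\<close> once
    \<open>i < k\<close>.\<close>
  define D where "D = rec_nat (\<lambda>_ _. 0) (\<lambda>_ h z. G (z 0) (h (suffix 1 z)))"
  have D: "D (Suc k) z = G (z 0) (D k (suffix 1 z))" for k z
    by (simp add: D_def)
  have step: "i < k \<Longrightarrow> D (Suc k) z i = D k z i" for k z i
  proof (induction k arbitrary: z i)
    case (Suc k)
    show ?case
      unfolding D[of "Suc k"] D[of k]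
      by (rule contractionD[OF assms], unfold D[symmetric], rule Suc.IH) (use Suc.prems in simp)
  qed simp
  have stable: "D m z i = D (Suc i) z i" if "i < m" for m z i
    using that
  proof (induction m)
    case (Suc m)
    show ?case
    proof (cases "i = m")
      case False
      then have "i < m" using Suc.prems by simp
      then show ?thesis using Suc.IH step[of i m z] by metis
    qed simp
  qed simp
  define X where "X z n = D (Suc n) z n" for z n
  have eq: "X z = G (z 0) (X (suffix 1 z))" for z
  proof
    fix n
    have "X z n = G (z 0) (D n (suffix 1 z)) n" by (simp add: X_def D)
    also have "\<dots> = G (z 0) (X (suffix 1 z)) n"
      by (rule contractionD[OF assms], unfold X_def, rule stable)
    finally show "X z n = G (z 0) (X (suffix 1 z)) n" .
  qed
  \<comment> \<open>Only the first \<open>k\<close> entries of \<open>z\<close> select factors in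
    \<open>D k z\<close>, so the diagonal limit \<open>X\<close> is continuous.\<close>
  have dep: "(\<forall>i<k. y i = z i) \<Longrightarrow> D k y = D k z" for k y z
  proof (induction k arbitrary: y z)
    case (Suc k)
    then have "D k (suffix 1 y) = D k (suffix 1 z)" by simp
    then show ?case using Suc.prems unfolding D by simp
  qed (simp add: D_def)
  have "continuous_on UNIV X"
  proof (rule continuous_on_sequencesI)
    fix z n
    show "\<exists>k. \<forall>y. (\<forall>i<k. y i = z i) \<longrightarrow> X y n = X z n"
      using dep[of "Suc n" _ z] by (intro exI[of _ "Suc n"] allI impI) (simp only: X_def)
  qed
  with eq show thesis using that by blast
qed

text \<open>Compose \<open>g\<close> with itself infinitely often, along the constant sequence
  \<open>0\<close>. This sequence equals its own suffix, so the value is fixed by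
  \<open>g\<close>.\<close>

lemma contraction_fixed_point:
  assumes "contraction g"
  obtains x where "g x = x"
proof -
  obtain X where "\<And>z :: nat \<Rightarrow> nat. X z = g (X (suffix 1 z))"
    using ex_infinite_composition[of "\<lambda>_. g"] assms by blast
  moreover have "suffix 1 (\<lambda>_. 0) = (\<lambda>_. 0 :: nat)" by (simp add: fun_eq_iff)
  ultimately show thesis using that by metis
qed

section \<open>Games\<close>

text \<open>Player I spells \<open>x\<close> at even stages, player II spells \<open>y\<close> at
  odd ones. A winning strategy answers every sequence of the opponent, and the order of the moves
  makes the resulting map a contraction or nonexpansive.\<close>

lemma wadge_game:
  assumes "determined {z. R (\<lambda>n. z (2 * n)) (\<lambda>n. z (2 * n + 1))}"
  obtains g where "contraction g" "\<And>y. R (g y) y"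
  | f where "nonexpansive f" "\<And>x. \<not> R x (f x)"
  using assms unfolding determined_def
proof (elim disjE exE)
  fix \<sigma> assume \<sigma>: "winning_for_I {z. R (\<lambda>n. z (2 * n)) (\<lambda>n. z (2 * n + 1))} \<sigma>"
  \<comment> \<open>The run in which II plays the digits of \<open>y\<close> and I follows
    \<open>\<sigma>\<close> is generated by \<open>F y\<close>.\<close>
  define F where "F y l = (if even (length l) then \<sigma> l else y (length l div 2))"
    for y :: "nat \<Rightarrow> nat" and l
  obtain r where r: "\<And>y n. r y n = F y (map (r y) [0..<n])"
    using ex_sequence_by_recursion[of "F _"] by metis
  define g where "g y n = r y (2 * n)" for y n
  have ev: "r y (2 * n) = \<sigma> (map (r y) [0..<2 * n])" for y n
    by (subst r) (simp add: F_def)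
  have od: "r y (2 * n + 1) = y n" for y n
    by (subst r) (simp add: F_def)
  have "contraction g"
    unfolding contraction_def
  proof (intro allI impI)
    fix n and x y :: "nat \<Rightarrow> nat"
    assume a: "\<forall>i<n. x i = y i"
    have "m \<le> 2 * n \<Longrightarrow> r x m = r y m" for m
    proof (induction m rule: less_induct)
      case (less m)
      have m: "map (r x) [0..<m] = map (r y) [0..<m]" using less by simp
      have "x (m div 2) = y (m div 2)" if "odd m"
        using a less.prems that by (auto elim!: oddE)
      then have "F x (map (r x) [0..<m]) = F y (map (r y) [0..<m])"
        unfolding m by (simp add: F_def)
      then show ?case using r by metis
    qed
    then show "g x n = g y n" by (simp add: g_def)
  qed
  moreover have "R (g y) y" for y
  proof -
    have "r y \<in> {z. R (\<lambda>n. z (2 * n)) (\<lambda>n. z (2 * n + 1))}"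
      using \<sigma> ev unfolding winning_for_I_def by blast
    then show ?thesis unfolding mem_Collect_eq od g_def .
  qed
  ultimately show thesis by (rule that(1))
next
  fix \<tau> assume \<tau>: "winning_for_II {z. R (\<lambda>n. z (2 * n)) (\<lambda>n. z (2 * n + 1))} \<tau>"
  define F where "F x l = (if even (length l) then x (length l div 2) else \<tau> l)"
    for x :: "nat \<Rightarrow> nat" and l
  obtain r where r: "\<And>y n. r y n = F y (map (r y) [0..<n])"
    using ex_sequence_by_recursion[of "F _"] by metis
  define f where "f y n = r y (2 * n + 1)" for y n
  have ev: "r y (2 * n) = y n" for y n
    by (subst r) (simp add: F_def)
  have od: "r y (2 * n + 1) = \<tau> (map (r y) [0..<2 * n + 1])" for y n
    by (subst r) (simp add: F_def)
  have "nonexpansive f"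
    unfolding nonexpansive_def
  proof (intro allI impI)
    fix n and x y :: "nat \<Rightarrow> nat"
    assume a: "\<forall>i\<le>n. x i = y i"
    have "m \<le> 2 * n + 1 \<Longrightarrow> r x m = r y m" for m
    proof (induction m rule: less_induct)
      case (less m)
      have m: "map (r x) [0..<m] = map (r y) [0..<m]" using less by simp
      have "x (m div 2) = y (m div 2)"
        using a less.prems by auto
      then have "F x (map (r x) [0..<m]) = F y (map (r y) [0..<m])"
        unfolding m by (simp add: F_def)
      then show ?case using r by metis
    qed
    then show "f x n = f y n" by (simp add: f_def)
  qed
  moreover have "\<not> R x (f x)" for x
  proof -
    have "r x \<notin> {z. R (\<lambda>n. z (2 * n)) (\<lambda>n. z (2 * n + 1))}"
      using \<tau> od unfolding winning_for_II_def by blast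
    then show ?thesis unfolding mem_Collect_eq ev f_def .
  qed
  ultimately show thesis by (rule that(2))
qed

section \<open>Baire category\<close>

text \<open>Comeagre sets: each member of the family contains a dense open set, with density
  witnessed by extensions of finite words.\<close>

definition residual :: "(nat \<Rightarrow> nat) set \<Rightarrow> bool" where
  "residual T \<longleftrightarrow> (\<exists>\<O>. countable \<O> \<and>
     (\<forall>V\<in>\<O>. \<forall>w. \<exists>v. \<forall>z. (w @ v) \<frown> z \<in> V) \<and> \<Inter>\<O> \<subseteq> T)"

lemma residual_mono:
  assumes "residual A" "A \<subseteq> B"
  shows "residual B"
proof -
  obtain \<O> where "countable \<O>" "\<forall>V\<in>\<O>. \<forall>w. \<exists>v. \<forall>z. (w @ v) \<frown> z \<in> V" "\<Inter>\<O> \<subseteq> A"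
    using assms(1) unfolding residual_def by blast
  then show ?thesis unfolding residual_def
    using assms(2) by (intro exI[of _ \<O>]) simp
qed

lemma residual_Int:
  assumes "residual A" "residual B"
  shows "residual (A \<inter> B)"
proof -
  obtain \<O> \<O>' where
    "countable \<O>" "\<forall>V\<in>\<O>. \<forall>w. \<exists>v. \<forall>z. (w @ v) \<frown> z \<in> V" "\<Inter>\<O> \<subseteq> A"
    "countable \<O>'" "\<forall>V\<in>\<O>'. \<forall>w. \<exists>v. \<forall>z. (w @ v) \<frown> z \<in> V" "\<Inter>\<O>' \<subseteq> B"
    using assms unfolding residual_def by blast
  then show ?thesis unfolding residual_def
    by (intro exI[of _ "\<O> \<union> \<O>'"]) auto
qed

text \<open>A comeagre set is comeagre in every cylinder: density is applied to \<open>u @ w\<close>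
  in place of \<open>w\<close>.\<close>

lemma residual_conc:
  assumes "residual T"
  shows "residual {z. u \<frown> z \<in> T}"
proof -
  obtain \<O> where \<O>: "countable \<O>" "\<forall>V\<in>\<O>. \<forall>w. \<exists>v. \<forall>z. (w @ v) \<frown> z \<in> V" "\<Inter>\<O> \<subseteq> T"
    using assms unfolding residual_def by blast
  have "\<exists>v. \<forall>z. u \<frown> ((w @ v) \<frown> z) \<in> V" if "V \<in> \<O>" for V w
  proof -
    have "\<forall>w. \<exists>v. \<forall>z. (w @ v) \<frown> z \<in> V" using \<O>(2) that by (rule bspec)
    then have "\<exists>v. \<forall>z. ((u @ w) @ v) \<frown> z \<in> V" by (rule spec)
    then obtain v where "\<forall>z. ((u @ w) @ v) \<frown> z \<in> V" ..
    then show ?thesis by (intro exI[of _ v]) simp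
  qed
  then show ?thesis unfolding residual_def using \<O>(1,3)
    by (intro exI[of _ "(\<lambda>V. {z. u \<frown> z \<in> V}) ` \<O>"]) auto
qed

text \<open>The Baire category theorem: the point is the limit of words that enter the dense sets
  one after the other.\<close>

lemma residual_nonempty:
  assumes "residual T"
  shows "\<exists>z. z \<in> T"
proof -
  obtain \<O> where \<O>: "countable \<O>" "\<forall>V\<in>\<O>. \<forall>w. \<exists>v. \<forall>z. (w @ v) \<frown> z \<in> V" "\<Inter>\<O> \<subseteq> T"
    using assms unfolding residual_def by blast
  \<comment> \<open>Inserting \<open>UNIV\<close> allows an enumeration also when
    \<open>\<O>\<close> is empty.\<close>
  define V where "V = from_nat_into (insert UNIV \<O>)"
  have V: "\<exists>v. \<forall>z. (w @ v) \<frown> z \<in> V i" for i w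
    using \<O>(2) from_nat_into[of "insert UNIV \<O>" i] unfolding V_def by auto
  define \<phi> where "\<phi> i w = (SOME v. \<forall>z. (w @ v) \<frown> z \<in> V i)" for i w
  have \<phi>: "(w @ \<phi> i w) \<frown> z \<in> V i" for i w z
    using someI_ex[OF V] unfolding \<phi>_def by blast
  \<comment> \<open>The final digit \<open>0\<close> forces the lengths to grow even if the
    extensions \<open>\<phi>\<close> are empty words.\<close>
  define W where "W = rec_nat [] (\<lambda>i w. w @ \<phi> i w @ [0])"
  have W: "W (Suc i) = W i @ \<phi> i (W i) @ [0]" for i by (simp add: W_def)
  have len: "i \<le> length (W i)" for i by (induction i) (simp_all add: W W_def)
  have pre: "n < length (W i) \<Longrightarrow> W (i + k) ! n = W i ! n \<and> n < length (W (i + k))" for i n k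
    by (induction k) (auto simp: W nth_append)
  define z where "z n = W (Suc n) ! n" for n
  have z: "z n = W i ! n" if "n < length (W i)" for n i
  proof -
    have "n < length (W (Suc n))" using len[of "Suc n"] by simp
    then show ?thesis
      using pre[of n "Suc n" i] pre[of n i "Suc n"] that by (simp add: z_def add.commute)
  qed
  have "z \<in> V i" for i
  proof -
    have "z = (W i @ \<phi> i (W i)) \<frown> suffix (length (W i @ \<phi> i (W i))) z"
    proof
      fix n
      show "z n = ((W i @ \<phi> i (W i)) \<frown> suffix (length (W i @ \<phi> i (W i))) z) n"
        using z[of n "Suc i"] by (cases "n < length (W i @ \<phi> i (W i))") (auto simp: W nth_append)
    qed
    then show ?thesis using \<phi> by metis
  qed
  moreover have "\<O> \<subseteq> range V"
    unfolding V_def using \<O>(1) by (auto simp: range_from_nat_into)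
  ultimately have "z \<in> \<Inter>\<O>" by blast
  with \<O>(3) show ?thesis by blast
qed

section \<open>The Banach-Mazur game\<close>

text \<open>In the Banach--Mazur game, the move \<open>a\<close> stands for the non-empty word \<open>block a\<close>.\<close>

definition block :: "nat \<Rightarrow> nat list" where
  "block a = from_nat a @ [0]"

definition blocks :: "nat list \<Rightarrow> nat list" where
  "blocks p = concat (map block p)"

text \<open>Blocks are non-empty, so \<open>n + 1\<close> of them already contain digit
  \<open>n\<close> of the infinite concatenation.\<close>

definition unblock :: "(nat \<Rightarrow> nat) \<Rightarrow> nat \<Rightarrow> nat" where
  "unblock y n = blocks (map y [0..<Suc n]) ! n"

lemma blocks_append: "blocks (p @ q) = blocks p @ blocks q"
  by (simp add: blocks_def)

lemma length_blocks: "length p \<le> length (blocks p)"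
  by (induction p) (simp_all add: blocks_def block_def)

lemma unblock_nth:
  assumes "i < length (blocks (map y [0..<m]))"
  shows "unblock y i = blocks (map y [0..<m]) ! i"
proof -
  have pre: "blocks (map y [0..<b]) ! i = blocks (map y [0..<a]) ! i"
    if "i < length (blocks (map y [0..<a]))" "a \<le> b" for a b
  proof -
    have "[0..<b] = [0..<a] @ [a..<b]"
      using that(2) by (metis le_add_diff_inverse upt_add_eq_append zero_le)
    then show ?thesis using that(1) by (simp add: blocks_append nth_append)
  qed
  have "i < length (blocks (map y [0..<Suc i]))"
    using length_blocks[of "map y [0..<Suc i]"] by simp
  then show ?thesis
    using pre[of "Suc i" m] pre[of m "Suc i"] assms unfolding unblock_def
    by (cases "Suc i \<le> m") auto
qed

lemma continuous_unblock: "continuous_on UNIV unblock"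
proof (rule continuous_on_sequencesI)
  fix x n
  show "\<exists>k. \<forall>y. (\<forall>i<k. y i = x i) \<longrightarrow> unblock y n = unblock x n"
  proof (intro exI[of _ "Suc n"] allI impI)
    fix y assume "\<forall>i<Suc n. y i = x i"
    then have "map y [0..<Suc n] = map x [0..<Suc n]" by simp
    then show "unblock y n = unblock x n" unfolding unblock_def by metis
  qed
qed

text \<open>
  The dense open set attached to a position \<open>p\<close> says that an outcome extending the word of \<open>p\<close> also
  extends the word of a position that follows \<open>p\<close> with an answer by \<open>\<tau>\<close>.
\<close>

lemma residual_outcomes:
  fixes \<tau> :: "nat list \<Rightarrow> nat"
  shows "residual {z. \<exists>y. map y [0..<length q] = q \<and> unblock y = blocks q \<frown> z \<and>
    (\<forall>k. y (length q + 2 * k + 1) = \<tau> (map y [0..<length q + 2 * k + 1]))}"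
proof -
  define ext where "ext l z \<longleftrightarrow> (\<forall>i<length l. (z :: nat \<Rightarrow> nat) i = l ! i)" for l z
  \<comment> \<open>The word \<open>q\<close> is a fixed opening of the run; after it, free moves
    alternate with answers by \<open>\<tau>\<close>.\<close>
  define nxt where "nxt p a = p @ [a, \<tau> (q @ p @ [a])]" for p a
  define V where "V p = {z. ext (blocks p) z \<longrightarrow> (\<exists>a. ext (blocks (nxt p a)) z)}" for p
  have ext_conc: "ext l ((l @ m) \<frown> z)" for l m z
    by (simp add: ext_def nth_append)
  have dense: "\<exists>v. \<forall>z. (w @ v) \<frown> z \<in> V p" for w p
  proof -
    have answer: "\<exists>v. \<forall>z. (w @ u @ v) \<frown> z \<in> V p" if "w @ u = blocks p @ s" for u s
    proof -
      \<comment> \<open>The free move is chosen so that \<open>block a\<close> is \<open>s\<close>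
        followed by \<open>0\<close>: it completes the word \<open>w @ u @ [0]\<close>, and the
        answer by \<open>\<tau>\<close> comes next.\<close>
      define a where "a = to_nat s"
      have "blocks (nxt p a) = w @ u @ 0 # block (\<tau> (q @ p @ [a]))"
        using that by (simp add: nxt_def blocks_def block_def a_def)
      then have "ext (blocks (nxt p a)) ((w @ u @ 0 # block (\<tau> (q @ p @ [a]))) \<frown> z)" for z
        using ext_conc[of "blocks (nxt p a)" "[]" z] by simp
      then show ?thesis unfolding V_def
        by (intro exI[of _ "0 # block (\<tau> (q @ p @ [a]))"]) blast
    qed
    show ?thesis
    \<comment> \<open>If \<open>w\<close> contradicts the word of \<open>p\<close>, the condition is
      void on the cylinder of \<open>w\<close>. Otherwise one word extends the other and
      \<open>answer\<close> applies.\<close>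
    proof (cases "\<forall>i<min (length w) (length (blocks p)). w ! i = blocks p ! i")
      case False
      then obtain i where i: "i < length w" "i < length (blocks p)" "w ! i \<noteq> blocks p ! i" by auto
      have "\<not> ext (blocks p) ((w @ []) \<frown> z)" for z
        using i by (auto simp: ext_def intro!: exI[of _ i])
      then show ?thesis unfolding V_def by blast
    next
      case True
      show ?thesis
      proof (cases "length w \<le> length (blocks p)")
        case le: True
        have "w = take (length w) (blocks p)"
          using True le by (intro nth_equalityI) auto
        then have "w @ drop (length w) (blocks p) = blocks p @ []"
          by (metis append_Nil2 append_take_drop_id)
        from answer[OF this] show ?thesis by (metis append.assoc)
      next
        case False
        have "blocks p = take (length (blocks p)) w"
          using True False by (intro nth_equalityI) auto
        then have "w @ [] = blocks p @ drop (length (blocks p)) w"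
          by (metis append_Nil2 append_take_drop_id)
        from answer[OF this] show ?thesis by simp
      qed
    qed
  qed
  have "\<exists>y. map y [0..<length q] = q \<and> unblock y = blocks q \<frown> z \<and>
    (\<forall>k. y (length q + 2 * k + 1) = \<tau> (map y [0..<length q + 2 * k + 1]))"
    if z: "z \<in> \<Inter>(range V)" for z
  proof -
    have "\<exists>a. ext (blocks p) z \<longrightarrow> ext (blocks (nxt p a)) z" for p
      using z unfolding V_def by blast
    then obtain \<alpha> where \<alpha>: "\<And>p. ext (blocks p) z \<Longrightarrow> ext (blocks (nxt p (\<alpha> p))) z" by metis
    \<comment> \<open>Iterating the choice \<open>\<alpha>\<close> from the empty position gives a
      run that obeys \<open>\<tau>\<close> and spells the prescribed outcome \<open>z\<close> after
      the opening.\<close>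
    define P where "P = rec_nat [] (\<lambda>_ p. nxt p (\<alpha> p))"
    have P0: "P 0 = []" and PS: "P (Suc k) = nxt (P k) (\<alpha> (P k))" for k
      by (simp_all add: P_def)
    have extP: "ext (blocks (P k)) z" for k
      by (induction k) (simp_all add: P0 PS \<alpha>, simp add: ext_def blocks_def)
    have lenP: "length (P k) = 2 * k" for k
      by (induction k) (simp_all add: P0 PS nxt_def)
    have preP: "n < 2 * i \<Longrightarrow> P (i + k) ! n = P i ! n" for i n k
      by (induction k) (auto simp: PS nxt_def nth_append lenP)
    define y where "y = q \<frown> (\<lambda>n. P (Suc n) ! n)"
    have yq: "map y [0..<length q] = q"
      by (auto simp: y_def intro: nth_equalityI)
    have yP: "y (length q + n) = P k ! n" if "n < 2 * k" for n k
      using preP[of n "Suc n" k] preP[of n k "Suc n"] that by (simp add: y_def add.commute)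
    have ymap: "map y [0..<length q + 2 * k] = q @ P k" for k
    proof (rule nth_equalityI)
      fix i assume "i < length (map y [0..<length q + 2 * k])"
      then show "map y [0..<length q + 2 * k] ! i = (q @ P k) ! i"
        using yP[of "i - length q" k] by (cases "i < length q") (auto simp: nth_append y_def)
    qed (simp add: lenP)
    have \<tau>: "y (length q + 2 * k + 1) = \<tau> (map y [0..<length q + 2 * k + 1])" for k
    proof -
      have 1: "y (length q + 2 * k) = \<alpha> (P k)"
        using yP[of "2 * k" "Suc k"] by (simp add: PS nxt_def nth_append lenP)
      have 2: "y (length q + 2 * k + 1) = \<tau> (q @ P k @ [\<alpha> (P k)])"
        using yP[of "2 * k + 1" "Suc k"] by (simp add: PS nxt_def nth_append lenP)
      show ?thesis using ymap[of k] unfolding 2 by (simp add: 1)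
    qed
    have "unblock y i = (blocks q \<frown> z) i" for i
    proof -
      have len: "i < length (blocks (P (Suc i)))"
        using length_blocks[of "P (Suc i)"] by (simp add: lenP)
      moreover have "blocks (map y [0..<length q + 2 * Suc i]) = blocks q @ blocks (P (Suc i))"
        unfolding ymap blocks_append ..
      ultimately have "unblock y i = (blocks q @ blocks (P (Suc i))) ! i"
        using unblock_nth[of i y "length q + 2 * Suc i"] by (metis length_append trans_less_add2)
      then show ?thesis
        using extP[of "Suc i"] len by (cases "i < length (blocks q)") (auto simp: ext_def nth_append)
    qed
    then show ?thesis using yq \<tau> by blast
  qed
  then show ?thesis unfolding residual_def using dense
    by (intro exI[of _ "range V"]) auto
qed

text \<open>Comeagrely many outcomes arise from runs that obey the winning strategy. If it belongs
  to I, the opening \<open>\<sigma> []\<close> comes first and he is the one who answers afterwards,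
  so the conclusion is local to the cylinder of the first block.\<close>

lemma banach_mazur:
  assumes "determined (unblock -` T)"
  shows "residual (- T) \<or> (\<exists>s. residual {z. s \<frown> z \<in> T})"
  using assms unfolding determined_def
proof (elim disjE exE)
  fix \<sigma> assume \<sigma>: "winning_for_I (unblock -` T) \<sigma>"
  have "residual {z. blocks [\<sigma> []] \<frown> z \<in> T}"
  proof (rule residual_mono[OF residual_outcomes[of "[\<sigma> []]" \<sigma>]], rule subsetI, elim CollectE exE conjE)
    fix z y
    assume y: "map y [0..<length [\<sigma> []]] = [\<sigma> []]" "unblock y = blocks [\<sigma> []] \<frown> z"
      "\<forall>k. y (length [\<sigma> []] + 2 * k + 1) = \<sigma> (map y [0..<length [\<sigma> []] + 2 * k + 1])"
    have "y (2 * n) = \<sigma> (map y [0..<2 * n])" for n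
    proof (cases n)
      case (Suc k)
      then show ?thesis using y(3)[rule_format, of k] by simp
    qed (use y(1) in simp)
    then have "y \<in> unblock -` T" using \<sigma> unfolding winning_for_I_def by blast
    then show "z \<in> {z. blocks [\<sigma> []] \<frown> z \<in> T}" using y(2) by simp
  qed
  then show ?thesis by blast
next
  fix \<tau> assume \<tau>: "winning_for_II (unblock -` T) \<tau>"
  have "residual (- T)"
  proof (rule residual_mono[OF residual_outcomes[of "[]" \<tau>]], rule subsetI, elim CollectE exE conjE)
    fix z y
    assume "unblock y = blocks [] \<frown> z" and y:
      "\<forall>k. y (length [] + 2 * k + 1) = \<tau> (map y [0..<length [] + 2 * k + 1])"
    then have "unblock y = z" by (simp add: blocks_def)
    moreover have "y \<notin> unblock -` T"
      using \<tau> y unfolding winning_for_II_def by simp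
    ultimately show "z \<in> - T" by simp
  qed
  then show ?thesis by blast
qed

section \<open>The flip alternative\<close>

text \<open>This isolates what the games use of the pointclass: its value at the Baire
  space.\<close>

locale determined_algebra =
  fixes \<S> :: "(nat \<Rightarrow> nat) set set"
  assumes det: "A \<in> \<S> \<Longrightarrow> determined A"
    and borel_in: "A \<in> sets borel \<Longrightarrow> A \<in> \<S>"
    and borel_vimage_in: "f \<in> borel_measurable borel \<Longrightarrow> A \<in> \<S> \<Longrightarrow> f -` A \<in> \<S>"
    and Compl_in: "A \<in> \<S> \<Longrightarrow> - A \<in> \<S>"
    and Int_in: "A \<in> \<S> \<Longrightarrow> B \<in> \<S> \<Longrightarrow> A \<inter> B \<in> \<S>"
begin

lemma vimage_in: "continuous_on UNIV f \<Longrightarrow> A \<in> \<S> \<Longrightarrow> f -` A \<in> \<S>"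
  by (intro borel_vimage_in borel_measurable_continuous_onI)

lemma Un_in: "A \<in> \<S> \<Longrightarrow> B \<in> \<S> \<Longrightarrow> A \<union> B \<in> \<S>"
  using Compl_in[OF Int_in[OF Compl_in Compl_in]] by (metis Compl_Int double_complement)

text \<open>These rules place the payoff sets of the games in \<open>\<S>\<close> by following the
  logical form of the payoff condition.\<close>

lemma Collect_in:
  "A \<in> \<S> \<Longrightarrow> continuous_on UNIV f \<Longrightarrow> {x. f x \<in> A} \<in> \<S>"
  "{x. P x} \<in> \<S> \<Longrightarrow> {x. \<not> P x} \<in> \<S>"
  "{x. P x} \<in> \<S> \<Longrightarrow> {x. Q x} \<in> \<S> \<Longrightarrow> {x. P x \<and> Q x} \<in> \<S>"
  "{x. P x} \<in> \<S> \<Longrightarrow> {x. Q x} \<in> \<S> \<Longrightarrow> {x. P x \<or> Q x} \<in> \<S>"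
  "{x. P x} \<in> \<S> \<Longrightarrow> {x. Q x} \<in> \<S> \<Longrightarrow> {x. P x \<longrightarrow> Q x} \<in> \<S>"
  "{x. P x} \<in> \<S> \<Longrightarrow> {x. Q x} \<in> \<S> \<Longrightarrow> {x. P x \<longleftrightarrow> Q x} \<in> \<S>"
proof -
  show 1: "{x. f x \<in> A} \<in> \<S>" if "A \<in> \<S>" "continuous_on UNIV f" for f A
    using vimage_in[OF that(2,1)] by (simp add: vimage_def)
  show 2: "{x. \<not> P x} \<in> \<S>" if "{x. P x} \<in> \<S>" for P
    using Compl_in[OF that] by (simp add: Collect_neg_eq)
  show 3: "{x. P x \<and> Q x} \<in> \<S>" if "{x. P x} \<in> \<S>" "{x. Q x} \<in> \<S>" for P Q
    using Int_in[OF that] by (simp add: Collect_conj_eq)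
  show 4: "{x. P x \<or> Q x} \<in> \<S>" if "{x. P x} \<in> \<S>" "{x. Q x} \<in> \<S>" for P Q
    using Un_in[OF that] by (simp add: Collect_disj_eq)
  show 5: "{x. P x \<longrightarrow> Q x} \<in> \<S>" if "{x. P x} \<in> \<S>" "{x. Q x} \<in> \<S>" for P Q
    using 4[OF 2[OF that(1)] that(2)] unfolding imp_conv_disj .
  show "{x. P x \<longleftrightarrow> Q x} \<in> \<S>" if "{x. P x} \<in> \<S>" "{x. Q x} \<in> \<S>"
  proof -
    have eq: "{x. P x \<longleftrightarrow> Q x} = {x. (P x \<longrightarrow> Q x) \<and> (Q x \<longrightarrow> P x)}" by blast
    show ?thesis unfolding eq using 3[OF 5[OF that] 5[OF that(2,1)]] .
  qed
qed

lemma continuous_parts: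
  "continuous_on UNIV (\<lambda>z n. z (2 * n) :: nat)"
  "continuous_on UNIV (\<lambda>z n. z (2 * n + 1) :: nat)"
  by (rule continuous_on_coordinatewise_then_product, rule continuous_on_product_coordinates)+

lemma continuous_comp: "continuous_on UNIV g \<Longrightarrow> continuous_on UNIV f \<Longrightarrow> continuous_on UNIV (\<lambda>x. g (f x))"
  by (rule continuous_on_compose2[of UNIV g UNIV f]) auto

text \<open>
  An argument of Martin and Monk: in an infinite composition of the two maps, whose factors are
  chosen by \<open>z\<close>, changing a single digit of \<open>z\<close> exchanges \<open>P\<close> and \<open>Q\<close>, against the Baire property.
  The assumptions on the complement of \<open>P \<union> Q\<close> ensure that \<open>P \<union> Q\<close> is reached.
\<close>

lemma no_flip_contractions:
  assumes S: "P \<in> \<S>" "Q \<in> \<S>" "N \<in> \<S>" and disj: "P \<inter> Q = {}" "N \<inter> (P \<union> Q) = {}"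
    and f: "contraction f" "f ` P \<subseteq> P" "f ` Q \<subseteq> Q" "f ` N \<subseteq> P \<union> Q"
    and g: "contraction g" "g ` P \<subseteq> Q" "g ` Q \<subseteq> P" "g ` (- (P \<union> Q \<union> N)) \<subseteq> P \<union> Q"
  shows False
proof -
  define G where "G a = (if a = 0 then f else g)" for a :: nat
  have "contraction (G a)" for a using f(1) g(1) by (simp add: G_def)
  then obtain X where X: "continuous_on UNIV X" "\<And>z :: nat \<Rightarrow> nat. X z = G (z 0) (X (suffix 1 z))"
    using ex_infinite_composition by blast
  have X1: "X ([a] \<frown> z) = G a (X z)" for a z
  proof -
    have "suffix 1 ([a] \<frown> z) = z" by (simp add: fun_eq_iff)
    then show ?thesis using X(2)[of "[a] \<frown> z"] by simp
  qed
  have Xc: "X ((a # s) \<frown> z) = G a (X (s \<frown> z))" for a s z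
    using X1[of a "s \<frown> z"] by simp
  \<comment> \<open>Once a tail has reached \<open>P \<union> Q\<close>, all further factors keep it
    there; likewise, two tails on opposite sides stay on opposite sides.\<close>
  have dec: "X (s \<frown> z) \<in> P \<union> Q" if "X z \<in> P \<union> Q" for s z
  proof (induction s)
    case (Cons a s)
    then show ?case using f(2,3) g(2,3) unfolding Xc G_def by auto
  qed (use that in simp)
  define opp where "opp x y \<longleftrightarrow> x \<in> P \<and> y \<in> Q \<or> x \<in> Q \<and> y \<in> P" for x y
  have opp: "opp (X (s \<frown> z)) (X (s \<frown> z'))" if "opp (X z) (X z')" for s z z'
  proof (induction s)
    case (Cons a s)
    then show ?case using f(2,3) g(2,3) unfolding Xc G_def opp_def by auto
  qed (use that in simp)
  have bm: "residual (- (X -` T)) \<or> (\<exists>s. residual {z. s \<frown> z \<in> X -` T})" if "T \<in> \<S>" for T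
    by (intro banach_mazur det vimage_in continuous_unblock X(1) that)
  define N' where "N' = - (P \<union> Q \<union> N)"
  have N': "N' \<in> \<S>" unfolding N'_def by (intro Compl_in Un_in S)
  have not_residual: "\<not> residual {z. s \<frown> z \<in> X -` T}" if T: "T = P \<or> T = Q \<or> T = N \<or> T = N'" for s T
  proof
    assume r: "residual {z. s \<frown> z \<in> X -` T}"
    \<comment> \<open>Genericity puts three points into the set at once; the last two,
      \<open>s \<frown> [0] \<frown> s \<frown> z\<close> and
      \<open>s \<frown> [1] \<frown> s \<frown> z\<close>, differ in one digit only.\<close>
    have "residual ({z. s \<frown> z \<in> X -` T} \<inter> {z. ([0] @ s) \<frown> z \<in> {z. s \<frown> z \<in> X -` T}} \<inter>
        {z. ([1] @ s) \<frown> z \<in> {z. s \<frown> z \<in> X -` T}})"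
      by (intro residual_Int residual_conc r)
    then obtain z where z: "X (s \<frown> z) \<in> T" "X (s \<frown> [0] \<frown> s \<frown> z) \<in> T" "X (s \<frown> [1] \<frown> s \<frown> z) \<in> T"
      using residual_nonempty by fastforce
    define x where "x = X (s \<frown> z)"
    have G: "X ([0] \<frown> s \<frown> z) = f x" "X ([1] \<frown> s \<frown> z) = g x"
      unfolding X1 x_def by (simp_all add: G_def)
    show False
    \<comment> \<open>On \<open>P\<close> and \<open>Q\<close>, the maps \<open>f\<close> and
      \<open>g\<close> send \<open>x\<close> to opposite sides. On \<open>N\<close> the map
      \<open>f\<close>, on \<open>N'\<close> the map \<open>g\<close>, sends it into
      \<open>P \<union> Q\<close>, which the composition then never leaves.\<close>
    proof (cases "T = P \<or> T = Q")
      case True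
      then have "opp (f x) (g x)"
        using f(2,3) g(2,3) z(1) unfolding opp_def x_def by blast
      then have "opp (X (s \<frown> [0] \<frown> s \<frown> z)) (X (s \<frown> [1] \<frown> s \<frown> z))"
        using G opp by metis
      then show False using True z(2,3) disj(1) unfolding opp_def by blast
    next
      case False
      then have "f x \<in> P \<union> Q \<or> g x \<in> P \<union> Q"
        using T z(1) f(4) g(4) unfolding x_def N'_def by blast
      then have "X (s \<frown> [0] \<frown> s \<frown> z) \<in> P \<union> Q \<or> X (s \<frown> [1] \<frown> s \<frown> z) \<in> P \<union> Q"
        using G dec by metis
      then show False using T False z(2,3) disj(2) unfolding N'_def by blast
    qed
  qed
  \<comment> \<open>Each of the four preimages is meagre, although together they cover the
    space.\<close>
  have "residual (- (X -` P) \<inter> - (X -` Q) \<inter> - (X -` N) \<inter> - (X -` N'))"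
    using bm[OF S(1)] bm[OF S(2)] bm[OF S(3)] bm[OF N'] not_residual by (intro residual_Int) auto
  then obtain z where "z \<in> - (X -` P) \<inter> - (X -` Q) \<inter> - (X -` N) \<inter> - (X -` N')"
    using residual_nonempty by blast
  then show False unfolding N'_def by blast
qed

text \<open>In one game I must preserve \<open>P\<close> and \<open>Q\<close> and send
  \<open>N\<close> into \<open>P \<union> Q\<close>; in the other he must exchange \<open>P\<close>
  and \<open>Q\<close> and send the remaining points there. By \<open>no_flip_contractions\<close>
  he cannot win both, and a win for II in the first or the second game gives the first or the second
  conclusion.\<close>

lemma flip_alternative:
  assumes S: "P \<in> \<S>" "Q \<in> \<S>" "N \<in> \<S>" and disj: "P \<inter> Q = {}" "N \<inter> (P \<union> Q) = {}"
  obtains f where "continuous_on UNIV f" "range f \<subseteq> P \<union> Q \<union> N" "f ` P \<subseteq> Q" "f ` Q \<subseteq> P"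
  | f where "continuous_on UNIV f" "range f \<subseteq> - N" "f ` P \<subseteq> P" "f ` Q \<subseteq> Q"
proof -
  define R where "R A B M x y \<longleftrightarrow> (y \<in> P \<longrightarrow> x \<in> A) \<and> (y \<in> Q \<longrightarrow> x \<in> B) \<and> (y \<in> M \<longrightarrow> x \<in> P \<or> x \<in> Q)"
    for A B M and x y :: "nat \<Rightarrow> nat"
  have R: "determined {z. R A B M (\<lambda>n. z (2 * n)) (\<lambda>n. z (2 * n + 1))}"
    if "A \<in> \<S>" "B \<in> \<S>" "M \<in> \<S>" for A B M
    unfolding R_def by (intro det Collect_in continuous_parts S that)
  define N' where "N' = - (P \<union> Q \<union> N)"
  have N': "N' \<in> \<S>" unfolding N'_def by (intro Compl_in Un_in S)
  consider f g where "contraction f" "\<And>y. R P Q N (f y) y" "contraction g" "\<And>y. R Q P N' (g y) y"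
    | f where "nonexpansive f" "\<And>x. \<not> R P Q N x (f x)"
    | f where "nonexpansive f" "\<And>x. \<not> R Q P N' x (f x)"
    using wadge_game[OF R[OF S]] wadge_game[OF R[OF S(2,1) N']] by metis
  then show thesis
  proof cases
    case 1
    then have False
      by (intro no_flip_contractions[OF S disj, of f g]) (auto simp: R_def N'_def)
    then show thesis ..
  next
    case 2
    show thesis
    proof (rule that(1)[of f])
      show "continuous_on UNIV f" by (rule nonexpansive_imp_continuous) fact
    qed (use 2(2) disj in \<open>auto simp: R_def\<close>)
  next
    case 3
    show thesis
    proof (rule that(2)[of f])
      show "continuous_on UNIV f" by (rule nonexpansive_imp_continuous) fact
    qed (use 3(2) disj in \<open>auto simp: R_def N'_def\<close>)
  qed
qed

end

section \<open>Retracts of the Baire space\<close>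

lemma mem_dual_class:
  assumes "\<Gamma> \<subseteq> Pow (topspace Z)"
  shows "A \<in> dual_class Z \<Gamma> \<longleftrightarrow> A \<subseteq> topspace Z \<and> topspace Z - A \<in> \<Gamma>"
proof
  assume "A \<in> dual_class Z \<Gamma>"
  then obtain B where B: "B \<in> \<Gamma>" "A = topspace Z - B" unfolding dual_class_def by blast
  then have "topspace Z - A = B" using assms by blast
  then show "A \<subseteq> topspace Z \<and> topspace Z - A \<in> \<Gamma>" using B by blast
next
  assume A: "A \<subseteq> topspace Z \<and> topspace Z - A \<in> \<Gamma>"
  then have "A = topspace Z - (topspace Z - A)" by blast
  then show "A \<in> dual_class Z \<Gamma>" using A unfolding dual_class_def by blast
qed

lemma dual_class_subset: "dual_class Z \<Gamma> \<subseteq> Pow (topspace Z)"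
  unfolding dual_class_def by blast

lemma dual_dual_class:
  assumes "\<Gamma> \<subseteq> Pow (topspace Z)"
  shows "dual_class Z (dual_class Z \<Gamma>) = \<Gamma>"
proof (intro set_eqI)
  fix A
  have "topspace Z - (topspace Z - A) = A" if "A \<subseteq> topspace Z" using that by blast
  then show "A \<in> dual_class Z (dual_class Z \<Gamma>) \<longleftrightarrow> A \<in> \<Gamma>"
    using assms unfolding mem_dual_class[OF dual_class_subset] mem_dual_class[OF assms] by auto
qed

lemma ambiguous_class_dual:
  assumes "\<Gamma> \<subseteq> Pow (topspace Z)"
  shows "ambiguous_class Z (dual_class Z \<Gamma>) = ambiguous_class Z \<Gamma>"
  unfolding ambiguous_class_def dual_dual_class[OF assms] by blast

text \<open>Games about subsets of \<open>Z\<close> are played with their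
  \<open>\<rho>\<close>-preimages. A map \<open>f\<close> obtained from a strategy then acts on
  \<open>Z\<close> as \<open>\<rho> \<circ> f \<circ> \<iota>\<close>.\<close>

locale baire_retract = determined_algebra +
  fixes Z :: "'a topology" and \<iota> :: "'a \<Rightarrow> nat \<Rightarrow> nat" and \<rho> :: "(nat \<Rightarrow> nat) \<Rightarrow> 'a"
  assumes cont_\<iota>: "continuous_map Z euclidean \<iota>"
    and cont_\<rho>: "continuous_map euclidean Z \<rho>"
    and \<rho>_\<iota>: "z \<in> topspace Z \<Longrightarrow> \<rho> (\<iota> z) = z"
begin

lemma \<rho>_in: "\<rho> x \<in> topspace Z"
  using cont_\<rho> by (auto simp: continuous_map_def)

lemma continuous_map_retract:
  assumes "continuous_on UNIV f"
  shows "continuous_map Z Z (\<lambda>z. \<rho> (f (\<iota> z)))"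
proof -
  have "continuous_map euclidean euclidean f" using assms by simp
  from continuous_map_compose[OF continuous_map_compose[OF cont_\<iota> this] cont_\<rho>]
  show ?thesis by (simp add: o_def)
qed

lemma vimage_\<rho>_Diff: "\<rho> -` (topspace Z - A) = - (\<rho> -` A)"
  using \<rho>_in by blast

text \<open>The closure properties of Wadge classes within the pointclass on which the games rely;
  they pass to the dual class.\<close>

definition boldface :: "'a set set \<Rightarrow> bool" where
  "boldface \<Gamma> \<longleftrightarrow> \<Gamma> \<subseteq> Pow (topspace Z) \<and>
     (\<forall>f A. continuous_map Z Z f \<and> A \<in> \<Gamma> \<longrightarrow> preimage_in Z f A \<in> \<Gamma>) \<and>
     (\<forall>A\<in>\<Gamma>. \<rho> -` A \<in> \<S>)"

lemma boldfaceD: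
  assumes "boldface \<Gamma>"
  shows "\<Gamma> \<subseteq> Pow (topspace Z)" "continuous_map Z Z f \<Longrightarrow> A \<in> \<Gamma> \<Longrightarrow> preimage_in Z f A \<in> \<Gamma>"
    "A \<in> \<Gamma> \<Longrightarrow> \<rho> -` A \<in> \<S>"
  using assms unfolding boldface_def by blast+

lemma preimage_Diff:
  assumes "continuous_map Z Z f"
  shows "preimage_in Z f (topspace Z - A) = topspace Z - preimage_in Z f A"
  using continuous_map_image_subset_topspace[OF assms] unfolding preimage_in_def by blast

lemma boldface_dual:
  assumes "boldface \<Gamma>"
  shows "boldface (dual_class Z \<Gamma>)"
proof -
  note \<Gamma> = boldfaceD[OF assms]
  have "preimage_in Z f (topspace Z - A) \<in> dual_class Z \<Gamma>" if "continuous_map Z Z f" "A \<in> \<Gamma>" for f A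
    using \<Gamma>(2)[OF that] unfolding preimage_Diff[OF that(1)] dual_class_def by blast
  moreover have "\<rho> -` (topspace Z - A) \<in> \<S>" if "A \<in> \<Gamma>" for A
    using Compl_in[OF \<Gamma>(3)[OF that]] unfolding vimage_\<rho>_Diff .
  ultimately show ?thesis
    unfolding boldface_def using dual_class_subset by (auto simp: dual_class_def)
qed

lemma mem_ambiguous_classI:
  assumes "boldface \<Gamma>" "A \<in> \<Gamma>" "B \<in> \<Gamma>" "A \<inter> B = {}" "topspace Z \<subseteq> A \<union> B"
  shows "A \<in> ambiguous_class Z \<Gamma>"
proof -
  note \<Gamma> = boldfaceD(1)[OF assms(1)]
  have "A \<subseteq> topspace Z" "B \<subseteq> topspace Z" using assms(2,3) \<Gamma> by blast+
  then have "topspace Z - A = B" using assms(4,5) by blast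
  then show ?thesis
    using \<open>A \<subseteq> topspace Z\<close> assms(2,3) unfolding ambiguous_class_def by (simp add: mem_dual_class[OF \<Gamma>])
qed

text \<open>If II wins the reduction game, his map sends all of \<open>Z\<close> into
  \<open>A\<^sub>0 \<union> A\<^sub>1\<close>, with \<open>B\<^sub>0\<close> going into
  \<open>A\<^sub>1\<close> and \<open>B\<^sub>1\<close> into \<open>A\<^sub>0\<close>. The preimage
  of \<open>A\<^sub>1\<close> would then separate \<open>B\<^sub>0\<close> from
  \<open>B\<^sub>1\<close>.\<close>

lemma ex_reduction_of_pair:
  assumes \<Gamma>: "boldface \<Gamma>"
    and A: "A\<^sub>0 \<in> \<Gamma>" "A\<^sub>1 \<in> \<Gamma>" "A\<^sub>0 \<inter> A\<^sub>1 = {}"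
    and B: "B\<^sub>0 \<in> dual_class Z \<Gamma>" "B\<^sub>1 \<in> dual_class Z \<Gamma>"
      "\<not> (\<exists>C\<in>ambiguous_class Z \<Gamma>. B\<^sub>0 \<subseteq> C \<and> C \<subseteq> topspace Z - B\<^sub>1)"
  shows "\<exists>f. continuous_map Z Z f \<and> f ` A\<^sub>0 \<subseteq> B\<^sub>0 \<and> f ` A\<^sub>1 \<subseteq> B\<^sub>1"
proof -
  note \<Gamma>' = boldfaceD[OF \<Gamma>] and D' = boldfaceD[OF boldface_dual[OF \<Gamma>]]
  define R where "R x y \<longleftrightarrow>
    (y \<in> \<rho> -` A\<^sub>0 \<longrightarrow> x \<in> \<rho> -` B\<^sub>0) \<and> (y \<in> \<rho> -` A\<^sub>1 \<longrightarrow> x \<in> \<rho> -` B\<^sub>1)" for x y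
  have "determined {z. R (\<lambda>n. z (2 * n)) (\<lambda>n. z (2 * n + 1))}"
    unfolding R_def
    by (intro det Collect_in continuous_parts \<Gamma>'(3) D'(3) A(1,2) B(1,2))
  then show ?thesis
  proof (cases rule: wadge_game)
    case (1 g)
    have top: "A\<^sub>0 \<subseteq> topspace Z" "A\<^sub>1 \<subseteq> topspace Z" using \<Gamma>'(1) A(1,2) by blast+
    have "\<rho> (g (\<iota> z)) \<in> B\<^sub>0" if "z \<in> A\<^sub>0" for z
      using 1(2)[of "\<iota> z"] that \<rho>_\<iota>[OF subsetD[OF top(1) that]] unfolding R_def by simp
    moreover have "\<rho> (g (\<iota> z)) \<in> B\<^sub>1" if "z \<in> A\<^sub>1" for z
      using 1(2)[of "\<iota> z"] that \<rho>_\<iota>[OF subsetD[OF top(2) that]] unfolding R_def by simp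
    ultimately show ?thesis
      using continuous_map_retract[OF contraction_imp_continuous[OF 1(1)]] by blast
  next
    case (2 f)
    define \<phi> where "\<phi> z = \<rho> (f (\<iota> z))" for z
    have \<phi>: "continuous_map Z Z \<phi>"
      unfolding \<phi>_def by (intro continuous_map_retract nonexpansive_imp_continuous 2(1))
    have *: "\<phi> z \<in> A\<^sub>0 \<and> z \<notin> B\<^sub>0 \<or> \<phi> z \<in> A\<^sub>1 \<and> z \<notin> B\<^sub>1" if "z \<in> topspace Z" for z
      using 2(2)[of "\<iota> z"] \<rho>_\<iota>[OF that] unfolding R_def \<phi>_def by auto
    have "preimage_in Z \<phi> A\<^sub>1 \<in> ambiguous_class Z \<Gamma>"
      by (rule mem_ambiguous_classI[OF \<Gamma> \<Gamma>'(2)[OF \<phi> A(2)] \<Gamma>'(2)[OF \<phi> A(1)]])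
        (use * A(3) in \<open>auto simp: preimage_in_def\<close>)
    moreover have "B\<^sub>0 \<subseteq> preimage_in Z \<phi> A\<^sub>1"
      using * D'(1) B(1) unfolding preimage_in_def by blast
    moreover have "preimage_in Z \<phi> A\<^sub>1 \<subseteq> topspace Z - B\<^sub>1"
      using * A(3) unfolding preimage_in_def by blast
    ultimately show ?thesis using B(3) by blast
  qed
qed

lemma separation_property_self_or_dual:
  assumes \<Gamma>: "boldface \<Gamma>"
  shows "separation_property Z \<Gamma> \<or> separation_property Z (dual_class Z \<Gamma>)"
proof (rule ccontr)
  note \<Gamma>' = boldfaceD[OF \<Gamma>] and D' = boldfaceD[OF boldface_dual[OF \<Gamma>]]
  assume "\<not> ?thesis"
  then obtain A\<^sub>0 A\<^sub>1 B\<^sub>0' B\<^sub>1' where A: "A\<^sub>0 \<in> \<Gamma>" "A\<^sub>1 \<in> \<Gamma>" "A\<^sub>0 \<inter> A\<^sub>1 = {}"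
      "\<And>C. C \<in> ambiguous_class Z \<Gamma> \<Longrightarrow> A\<^sub>0 \<subseteq> C \<Longrightarrow> \<not> C \<subseteq> topspace Z - A\<^sub>1"
    and B': "B\<^sub>0' \<in> dual_class Z \<Gamma>" "B\<^sub>1' \<in> dual_class Z \<Gamma>" "B\<^sub>0' \<inter> B\<^sub>1' = {}"
      "\<not> (\<exists>C\<in>ambiguous_class Z \<Gamma>. B\<^sub>0' \<subseteq> C \<and> C \<subseteq> topspace Z - B\<^sub>1')"
    unfolding separation_property_def ambiguous_class_dual[OF \<Gamma>'(1)] by metis
  obtain h where h: "continuous_map Z Z h" "h ` A\<^sub>0 \<subseteq> B\<^sub>0'" "h ` A\<^sub>1 \<subseteq> B\<^sub>1'"
    using ex_reduction_of_pair[OF \<Gamma> A(1-3) B'(1,2,4)] by blast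
  define B\<^sub>0 where "B\<^sub>0 = preimage_in Z h B\<^sub>0'"
  define B\<^sub>1 where "B\<^sub>1 = preimage_in Z h B\<^sub>1'"
  have B: "B\<^sub>0 \<in> dual_class Z \<Gamma>" "B\<^sub>1 \<in> dual_class Z \<Gamma>" "B\<^sub>0 \<inter> B\<^sub>1 = {}"
    using D'(2)[OF h(1)] B'(1-3) by (auto simp: B\<^sub>0_def B\<^sub>1_def preimage_in_def)
  have AB: "A\<^sub>0 \<subseteq> B\<^sub>0" "A\<^sub>1 \<subseteq> B\<^sub>1"
    using h(2,3) A(1,2) \<Gamma>'(1) by (auto simp: B\<^sub>0_def B\<^sub>1_def preimage_in_def)
  have top: "A\<^sub>0 \<subseteq> topspace Z" "B\<^sub>0 \<subseteq> topspace Z" "B\<^sub>1 \<subseteq> topspace Z"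
    using A(1) B \<Gamma>'(1) D'(1) by blast+
  have not_separable: False
    if "C \<in> ambiguous_class Z \<Gamma>" "A\<^sub>0 \<subseteq> C" "C \<inter> B\<^sub>1 = {}" for C
  proof -
    have "C \<subseteq> topspace Z"
      using that(1) \<Gamma>'(1) unfolding ambiguous_class_def by blast
    then show False using A(4)[OF that(1,2)] that(3) AB(2) by blast
  qed
  show False
  proof (rule flip_alternative[of "\<rho> -` A\<^sub>0" "\<rho> -` B\<^sub>1" "\<rho> -` B\<^sub>0 - \<rho> -` A\<^sub>0"])
    show "\<rho> -` A\<^sub>0 \<in> \<S>" "\<rho> -` B\<^sub>1 \<in> \<S>" using \<Gamma>'(3) D'(3) A B by blast+
    show "\<rho> -` B\<^sub>0 - \<rho> -` A\<^sub>0 \<in> \<S>"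
      unfolding Diff_eq by (intro Int_in Compl_in \<Gamma>'(3) D'(3) A B)
    show "\<rho> -` A\<^sub>0 \<inter> \<rho> -` B\<^sub>1 = {}" "(\<rho> -` B\<^sub>0 - \<rho> -` A\<^sub>0) \<inter> (\<rho> -` A\<^sub>0 \<union> \<rho> -` B\<^sub>1) = {}"
      using AB(1) B(3) by blast+
  next
    fix f
    assume f: "continuous_on UNIV f"
      "range f \<subseteq> \<rho> -` A\<^sub>0 \<union> \<rho> -` B\<^sub>1 \<union> (\<rho> -` B\<^sub>0 - \<rho> -` A\<^sub>0)"
      "f ` \<rho> -` A\<^sub>0 \<subseteq> \<rho> -` B\<^sub>1" "f ` \<rho> -` B\<^sub>1 \<subseteq> \<rho> -` A\<^sub>0"
    define \<phi> where "\<phi> z = \<rho> (f (\<iota> z))" for z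
    have \<phi>: "continuous_map Z Z \<phi>"
      unfolding \<phi>_def by (intro continuous_map_retract f(1))
    have 1: "\<phi> z \<in> B\<^sub>0 \<union> B\<^sub>1" for z
      using f(2) AB(1) unfolding \<phi>_def by blast
    have 2: "\<phi> z \<in> B\<^sub>1" if "z \<in> A\<^sub>0" for z
    proof -
      have "\<iota> z \<in> \<rho> -` A\<^sub>0" using \<rho>_\<iota>[OF subsetD[OF top(1) that]] that by simp
      then show ?thesis using f(3) unfolding \<phi>_def by blast
    qed
    have 3: "\<phi> z \<in> A\<^sub>0" if "z \<in> B\<^sub>1" for z
    proof -
      have "\<iota> z \<in> \<rho> -` B\<^sub>1" using \<rho>_\<iota>[OF subsetD[OF top(3) that]] that by simp
      then show ?thesis using f(4) unfolding \<phi>_def by blast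
    qed
    \<comment> \<open>All values of \<open>\<phi>\<close> lie in
      \<open>B\<^sub>0 \<union> B\<^sub>1\<close>, so the two preimages are complementary members of
      the dual class.\<close>
    have "preimage_in Z \<phi> B\<^sub>1 \<in> ambiguous_class Z (dual_class Z \<Gamma>)"
      by (rule mem_ambiguous_classI[OF boldface_dual[OF \<Gamma>] D'(2)[OF \<phi> B(2)] D'(2)[OF \<phi> B(1)]])
        (use 1 B(3) in \<open>auto simp: preimage_in_def\<close>)
    then show False
    proof (intro not_separable)
      show "A\<^sub>0 \<subseteq> preimage_in Z \<phi> B\<^sub>1" using 2 top(1) unfolding preimage_in_def by blast
      show "preimage_in Z \<phi> B\<^sub>1 \<inter> B\<^sub>1 = {}" using 3 AB(1) B(3) unfolding preimage_in_def by blast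
    qed (simp add: ambiguous_class_dual[OF \<Gamma>'(1)])
  next
    fix f
    assume f: "continuous_on UNIV f" "range f \<subseteq> - (\<rho> -` B\<^sub>0 - \<rho> -` A\<^sub>0)"
      "f ` \<rho> -` A\<^sub>0 \<subseteq> \<rho> -` A\<^sub>0" "f ` \<rho> -` B\<^sub>1 \<subseteq> \<rho> -` B\<^sub>1"
    define \<phi> where "\<phi> z = \<rho> (f (\<iota> z))" for z
    have \<phi>: "continuous_map Z Z \<phi>"
      unfolding \<phi>_def by (intro continuous_map_retract f(1))
    have 1: "\<phi> z \<in> B\<^sub>0 \<longleftrightarrow> \<phi> z \<in> A\<^sub>0" for z
      using f(2) AB(1) unfolding \<phi>_def by blast
    have 2: "\<phi> z \<in> A\<^sub>0" if "z \<in> A\<^sub>0" for z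
    proof -
      have "\<iota> z \<in> \<rho> -` A\<^sub>0" using \<rho>_\<iota>[OF subsetD[OF top(1) that]] that by simp
      then show ?thesis using f(3) unfolding \<phi>_def by blast
    qed
    have 3: "\<phi> z \<in> B\<^sub>1" if "z \<in> B\<^sub>1" for z
    proof -
      have "\<iota> z \<in> \<rho> -` B\<^sub>1" using \<rho>_\<iota>[OF subsetD[OF top(3) that]] that by simp
      then show ?thesis using f(4) unfolding \<phi>_def by blast
    qed
    \<comment> \<open>Since \<open>\<phi>\<close> avoids \<open>B\<^sub>0 - A\<^sub>0\<close>, one
      set is a preimage both of a member of \<open>\<Gamma>\<close> and of a member of its
      dual.\<close>
    have "preimage_in Z \<phi> A\<^sub>0 = preimage_in Z \<phi> B\<^sub>0" unfolding preimage_in_def using 1 by blast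
    then have "preimage_in Z \<phi> A\<^sub>0 \<in> ambiguous_class Z \<Gamma>"
      using \<Gamma>'(2)[OF \<phi> A(1)] D'(2)[OF \<phi> B(1)] unfolding ambiguous_class_def by simp
    then show False
    proof (rule not_separable)
      show "A\<^sub>0 \<subseteq> preimage_in Z \<phi> A\<^sub>0" using 2 top(1) unfolding preimage_in_def by blast
      show "preimage_in Z \<phi> A\<^sub>0 \<inter> B\<^sub>1 = {}" using 3 AB(1) B(3) unfolding preimage_in_def by blast
    qed
  qed
qed

end

section \<open>Inseparable differences\<close>

text \<open>
  Sequences are coded by the characteristic functions of their graphs.  This makes them points of
  the Cantor space, at the price of a decoding that is only a Borel map.
\<close>

definition encode_graph :: "(nat \<Rightarrow> nat) \<Rightarrow> nat \<Rightarrow> nat" where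
  "encode_graph x m = (if x (fst (prod_decode m)) = snd (prod_decode m) then 1 else 0)"

definition decode_graph :: "(nat \<Rightarrow> nat) \<Rightarrow> nat \<Rightarrow> nat" where
  "decode_graph c n = (LEAST k. c (prod_encode (n, k)) = 1)"

lemma open_digit_vimage: "open ((\<lambda>c :: nat \<Rightarrow> nat. c m) -` B)"
  by (intro open_vimage continuous_on_product_coordinates) (simp add: open_discrete)

text \<open>A code need not be a graph: several values may be marked for one argument, and
  \<open>decode_graph\<close> takes the least.\<close>

definition codes :: "(nat \<Rightarrow> nat) set" where
  "codes = {c. \<forall>n. \<exists>k. c (prod_encode (n, k)) = 1}"

lemma encode_graph_le: "encode_graph x m \<le> 1"
  by (simp add: encode_graph_def)

lemma encode_graph_codes: "encode_graph x \<in> codes"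
  by (simp add: encode_graph_def codes_def)

lemma decode_encode_graph: "decode_graph (encode_graph x) = x"
  unfolding decode_graph_def encode_graph_def by (intro ext Least_equality) (auto split: if_splits)

lemma continuous_encode_graph: "continuous_on UNIV encode_graph"
proof (rule continuous_on_sequencesI)
  fix x n
  show "\<exists>k. \<forall>y. (\<forall>i<k. y i = x i) \<longrightarrow> encode_graph y n = encode_graph x n"
    by (rule exI[of _ "Suc (fst (prod_decode n))"]) (simp add: encode_graph_def)
qed

lemma borel_codes: "codes \<in> sets borel"
proof -
  have "codes = (\<Inter>n. \<Union>k. (\<lambda>c. c (prod_encode (n, k))) -` {1})"
    by (auto simp: codes_def)
  also have "\<dots> \<in> sets borel"
    by (intro sets.countable_INT sets.countable_UN image_subsetI borel_open open_digit_vimage) auto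
  finally show ?thesis .
qed

lemma borel_decode_graph: "decode_graph \<in> borel_measurable borel"
proof (rule measurable_coordinatewise_then_product)
  fix n
  have "Measurable.pred borel (\<lambda>c :: nat \<Rightarrow> nat. c (prod_encode (n, k)) = 1)" for k
  proof -
    have eq: "{c \<in> space borel. c (prod_encode (n, k)) = 1} = (\<lambda>c. c (prod_encode (n, k))) -` {1}"
      by auto
    show ?thesis
      unfolding pred_def eq by (intro borel_open open_digit_vimage)
  qed
  from measurable_Least[OF this]
  have "(\<lambda>c. decode_graph c n) \<in> borel \<rightarrow>\<^sub>M count_space UNIV" unfolding decode_graph_def .
  then show "(\<lambda>c. decode_graph c n) \<in> borel_measurable borel"
    using measurable_compose[of _ borel "count_space UNIV" "\<lambda>n. n" borel] by simp
qed

text \<open>On codes the decoding is continuous: a marked value exists, and finitely many digits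
  reveal the least one.\<close>

lemma continuous_decode_graph:
  fixes f :: "(nat \<Rightarrow> nat) \<Rightarrow> nat \<Rightarrow> nat"
  assumes "continuous_on UNIV f" "range f \<subseteq> codes"
  shows "continuous_on UNIV (\<lambda>x. decode_graph (f x))"
proof (rule continuous_on_sequencesI)
  fix x n
  define k where "k = decode_graph (f x) n"
  define U where "U = {c :: nat \<Rightarrow> nat. c (prod_encode (n, k)) = 1 \<and> (\<forall>l<k. c (prod_encode (n, l)) \<noteq> 1)}"
  have dec: "decode_graph c n = k" if "c \<in> U" for c
    using that unfolding U_def decode_graph_def
    by (intro Least_equality) (auto simp: not_less[symmetric])
  have "U = (\<lambda>c. c (prod_encode (n, k))) -` {1} \<inter> (\<Inter>l\<in>{..<k}. (\<lambda>c. c (prod_encode (n, l))) -` (- {1}))"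
    by (auto simp: U_def)
  also have "open \<dots>"
    by (intro open_Int open_INT ballI open_digit_vimage) auto
  finally have "open (f -` U)" using assms(1) by (rule open_vimage)
  moreover have "x \<in> f -` U"
  proof -
    have "\<exists>k. f x (prod_encode (n, k)) = 1" using assms(2) unfolding codes_def by blast
    then have "f x (prod_encode (n, k)) = 1"
      unfolding k_def decode_graph_def by (rule LeastI_ex)
    moreover have "f x (prod_encode (n, l)) \<noteq> 1" if "l < k" for l
      using not_less_Least that unfolding k_def decode_graph_def by blast
    ultimately show ?thesis unfolding U_def by blast
  qed
  ultimately obtain m where m: "\<forall>y. (\<forall>i<m. y i = x i) \<longrightarrow> y \<in> f -` U"
    using open_imp_cylinder by blast
  have "\<forall>y. (\<forall>i<m. y i = x i) \<longrightarrow> decode_graph (f y) n = decode_graph (f x) n"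
  proof (intro allI impI)
    fix y assume "\<forall>i<m. y i = x i"
    then have "f y \<in> U" using m by blast
    then show "decode_graph (f y) n = decode_graph (f x) n" using dec by (simp only: k_def)
  qed
  then show "\<exists>m. \<forall>y. (\<forall>i<m. y i = x i) \<longrightarrow> decode_graph (f y) n = decode_graph (f x) n" ..
qed

section \<open>A non-selfdual class generated by one set\<close>

locale complete_set = baire_retract +
  fixes K \<Gamma>
  assumes K: "K \<subseteq> topspace Z" "\<rho> -` K \<in> \<S>"
    and \<Gamma>_eq: "\<Gamma> = {preimage_in Z f K |f. continuous_map Z Z f}"
    and not_selfdual: "\<not> selfdual Z \<Gamma>"
begin

lemma preimage_in_\<Gamma>:
  assumes "continuous_map Z euclidean u"
  shows "{z \<in> topspace Z. u z \<in> \<rho> -` K} \<in> \<Gamma>"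
proof -
  have "continuous_map Z Z (\<rho> \<circ> u)" using assms cont_\<rho> by (rule continuous_map_compose)
  then have "preimage_in Z (\<rho> \<circ> u) K \<in> \<Gamma>" unfolding \<Gamma>_eq by blast
  moreover have "preimage_in Z (\<rho> \<circ> u) K = {z \<in> topspace Z. u z \<in> \<rho> -` K}"
    by (simp add: preimage_in_def)
  ultimately show ?thesis by simp
qed

lemma preimage_in_comp:
  assumes "continuous_map Z Z f"
  shows "preimage_in Z f (preimage_in Z g A) = preimage_in Z (g \<circ> f) A"
  using continuous_map_image_subset_topspace[OF assms] unfolding preimage_in_def by auto

lemma boldface_\<Gamma>: "boldface \<Gamma>"
  unfolding boldface_def
proof (intro conjI allI impI ballI)
  show "\<Gamma> \<subseteq> Pow (topspace Z)" unfolding \<Gamma>_eq preimage_in_def by auto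
  show "preimage_in Z f A \<in> \<Gamma>" if f: "continuous_map Z Z f \<and> A \<in> \<Gamma>" for f A
  proof -
    obtain g where "A = preimage_in Z g K" "continuous_map Z Z g" using f unfolding \<Gamma>_eq by blast
    then show ?thesis using preimage_in_comp[of f] continuous_map_compose[of Z Z f Z g] f
      unfolding \<Gamma>_eq by blast
  qed
  show "\<rho> -` A \<in> \<S>" if A: "A \<in> \<Gamma>" for A
  proof -
    obtain g where g: "A = preimage_in Z g K" "continuous_map Z Z g" using A unfolding \<Gamma>_eq by blast
    have "g (\<rho> x) \<in> topspace Z" for x
      using continuous_map_image_subset_topspace[OF g(2)] \<rho>_in by blast
    then have "\<rho> -` A = (\<lambda>x. \<iota> (g (\<rho> x))) -` (\<rho> -` K)"
      using \<rho>_in \<rho>_\<iota> unfolding g(1) preimage_in_def by auto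
    moreover have "continuous_on UNIV (\<lambda>x. \<iota> (g (\<rho> x)))"
      using continuous_map_compose[OF continuous_map_compose[OF cont_\<rho> g(2)] cont_\<iota>]
      by (simp add: o_def)
    ultimately show ?thesis using vimage_in K(2) by metis
  qed
qed

text \<open>Otherwise \<open>\<rho> \<circ> f \<circ> \<iota>\<close> would reduce \<open>K\<close>
  to its complement and make the class selfdual.\<close>

lemma not_reducible_to_complement:
  assumes "continuous_on UNIV f"
  shows "\<exists>x. x \<in> \<rho> -` K \<longleftrightarrow> f x \<in> \<rho> -` K"
proof (rule ccontr)
  assume *: "\<not> ?thesis"
  define \<phi> where "\<phi> z = \<rho> (f (\<iota> z))" for z
  have \<phi>: "continuous_map Z Z \<phi>"
    unfolding \<phi>_def by (intro continuous_map_retract assms)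
  have "\<phi> z \<in> K \<longleftrightarrow> z \<notin> K" if "z \<in> topspace Z" for z
  proof -
    have "\<iota> z \<in> \<rho> -` K \<longleftrightarrow> f (\<iota> z) \<notin> \<rho> -` K" using * by blast
    then show ?thesis using \<rho>_\<iota>[OF that] by (simp add: \<phi>_def)
  qed
  then have pre: "preimage_in Z (\<phi> \<circ> h) K = topspace Z - preimage_in Z h K" if "continuous_map Z Z h" for h
    using continuous_map_image_subset_topspace[OF that] unfolding preimage_in_def by auto
  have compl: "topspace Z - A \<in> \<Gamma>" if A: "A \<in> \<Gamma>" for A
  proof -
    obtain h where h: "A = preimage_in Z h K" "continuous_map Z Z h" using A unfolding \<Gamma>_eq by blast
    have "continuous_map Z Z (\<phi> \<circ> h)" using h(2) \<phi> by (rule continuous_map_compose)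
    then show ?thesis using pre[OF h(2)] h(1) unfolding \<Gamma>_eq by blast
  qed
  have "selfdual Z \<Gamma>"
    unfolding selfdual_def
  proof (intro set_eqI)
    fix A
    have top: "\<Gamma> \<subseteq> Pow (topspace Z)" by (rule boldfaceD(1)[OF boldface_\<Gamma>])
    have "topspace Z - (topspace Z - A) = A" if "A \<subseteq> topspace Z" using that by blast
    then show "A \<in> \<Gamma> \<longleftrightarrow> A \<in> dual_class Z \<Gamma>"
      using compl[of A] compl[of "topspace Z - A"] top unfolding mem_dual_class[OF top] by auto
  qed
  then show False using not_selfdual by blast
qed

text \<open>Reductions to \<open>K\<close> can be made contractions: if II won the game, his map
  followed by \<open>e\<close> would reduce \<open>K\<close> to its complement.\<close>

lemma ex_contraction:
  assumes "continuous_on UNIV e"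
  obtains g where "contraction g" "\<And>x. g x \<in> \<rho> -` K \<longleftrightarrow> e x \<in> \<rho> -` K"
proof -
  define R where "R x y \<longleftrightarrow> (x \<in> \<rho> -` K \<longleftrightarrow> e y \<in> \<rho> -` K)" for x y
  have "determined {z. R (\<lambda>n. z (2 * n)) (\<lambda>n. z (2 * n + 1))}"
    unfolding R_def
    by (intro det Collect_in K(2) continuous_parts continuous_comp[OF assms continuous_parts(2)])
  then show thesis
  proof (cases rule: wadge_game)
    case (1 g)
    then show ?thesis using that unfolding R_def by blast
  next
    case (2 f)
    have "continuous_on UNIV (\<lambda>x. e (f x))"
      by (intro continuous_comp[OF assms] nonexpansive_imp_continuous 2(1))
    from not_reducible_to_complement[OF this] 2(2) show ?thesis unfolding R_def by blast
  qed
qed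

text \<open>Even and odd digits carry independent instances of \<open>K\<close>, so interleaving two
  reductions to \<open>K\<close> reduces a pair of sets to \<open>U\<^sub>0\<close> and
  \<open>U\<^sub>1\<close> simultaneously.\<close>

definition U\<^sub>0 :: "(nat \<Rightarrow> nat) set" where "U\<^sub>0 = {x. (\<lambda>n. x (2 * n)) \<in> \<rho> -` K}"
definition U\<^sub>1 :: "(nat \<Rightarrow> nat) set" where "U\<^sub>1 = {x. (\<lambda>n. x (2 * n + 1)) \<in> \<rho> -` K}"

lemma U_in: "U\<^sub>0 \<in> \<S>" "U\<^sub>1 \<in> \<S>"
  unfolding U\<^sub>0_def U\<^sub>1_def by (intro Collect_in K(2) continuous_parts)+

text \<open>The diagonal argument: contractions reducing both sides of a separating set to
  \<^term>\<open>K\<close> would have a common fixed point.\<close>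

lemma U_inseparable:
  assumes e: "continuous_on UNIV e\<^sub>0" "continuous_on UNIV e\<^sub>1"
    and excl: "\<And>x. e\<^sub>0 x \<in> \<rho> -` K \<longleftrightarrow> e\<^sub>1 x \<notin> \<rho> -` K"
    and sep: "\<And>x. x \<in> U\<^sub>0 - U\<^sub>1 \<Longrightarrow> e\<^sub>0 x \<in> \<rho> -` K" "\<And>x. x \<in> U\<^sub>1 - U\<^sub>0 \<Longrightarrow> e\<^sub>1 x \<in> \<rho> -` K"
  shows False
proof -
  obtain g\<^sub>0 g\<^sub>1 where g: "contraction g\<^sub>0" "\<And>x. g\<^sub>0 x \<in> \<rho> -` K \<longleftrightarrow> e\<^sub>0 x \<in> \<rho> -` K"
    "contraction g\<^sub>1" "\<And>x. g\<^sub>1 x \<in> \<rho> -` K \<longleftrightarrow> e\<^sub>1 x \<in> \<rho> -` K"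
    using ex_contraction[OF e(1)] ex_contraction[OF e(2)] by metis
  \<comment> \<open>The reductions are interleaved crosswise. At a fixed point \<open>x\<close>,
    membership in \<open>U\<^sub>0\<close> is decided by \<open>e\<^sub>1\<close> and membership in
    \<open>U\<^sub>1\<close> by \<open>e\<^sub>0\<close>, against \<open>sep\<close>.\<close>
  define g where "g x n = (if even n then g\<^sub>1 x (n div 2) else g\<^sub>0 x (n div 2))" for x n
  have "contraction g"
    unfolding contraction_def
  proof (intro allI impI)
    fix n and x y :: "nat \<Rightarrow> nat" assume *: "\<forall>i<n. x i = y i"
    have "g\<^sub>0 x (n div 2) = g\<^sub>0 y (n div 2)" "g\<^sub>1 x (n div 2) = g\<^sub>1 y (n div 2)"
      by (rule contractionD[OF g(1)] contractionD[OF g(3)]; use * in auto)+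
    then show "g x n = g y n" by (simp add: g_def)
  qed
  then obtain x where x: "g x = x" by (rule contraction_fixed_point)
  have "x (2 * n) = g\<^sub>1 x n" "x (2 * n + 1) = g\<^sub>0 x n" for n
    using fun_cong[OF x, of "2 * n"] fun_cong[OF x, of "2 * n + 1"] by (simp_all add: g_def)
  then have "x \<in> U\<^sub>0 \<longleftrightarrow> e\<^sub>1 x \<in> \<rho> -` K" "x \<in> U\<^sub>1 \<longleftrightarrow> e\<^sub>0 x \<in> \<rho> -` K"
    using g(2,4)[of x] unfolding U\<^sub>0_def U\<^sub>1_def by simp_all
  then show False using excl[of x] sep[of x] by blast
qed

text \<open>
  The first player of this game builds a graph code bit by bit and thus may delay the digits of the
  coded sequence; this moves the inseparable pair to the Cantor space.
\<close>

lemma ex_cantor_reduction: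
  obtains h where "continuous_on UNIV h"
    "\<And>x. x \<in> U\<^sub>0 - U\<^sub>1 \<Longrightarrow> h (encode_graph x) \<in> U\<^sub>0 - U\<^sub>1"
    "\<And>x. x \<in> U\<^sub>1 - U\<^sub>0 \<Longrightarrow> h (encode_graph x) \<in> U\<^sub>1 - U\<^sub>0"
proof -
  define R where "R c y \<longleftrightarrow> c \<in> codes \<and>
    \<not> ((c \<in> decode_graph -` (U\<^sub>0 - U\<^sub>1) \<longrightarrow> y \<in> U\<^sub>0 - U\<^sub>1) \<and>
       (c \<in> decode_graph -` (U\<^sub>1 - U\<^sub>0) \<longrightarrow> y \<in> U\<^sub>1 - U\<^sub>0))" for c y
  have S: "U\<^sub>0 - U\<^sub>1 \<in> \<S>" "U\<^sub>1 - U\<^sub>0 \<in> \<S>"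
    unfolding Diff_eq by (intro Int_in Compl_in U_in)+
  have "determined {z. R (\<lambda>n. z (2 * n)) (\<lambda>n. z (2 * n + 1))}"
    unfolding R_def
    by (intro det Collect_in continuous_parts S borel_in[OF borel_codes]
        borel_vimage_in[OF borel_decode_graph])
  then show thesis
  proof (cases rule: wadge_game)
    case (1 g)
    define x where "x y = decode_graph (g y)" for y
    have x: "continuous_on UNIV x"
      unfolding x_def using 1 by (intro continuous_decode_graph contraction_imp_continuous) (auto simp: R_def)
    have *: "x y \<in> U\<^sub>0 - U\<^sub>1 \<and> y \<notin> U\<^sub>0 - U\<^sub>1 \<or> x y \<in> U\<^sub>1 - U\<^sub>0 \<and> y \<notin> U\<^sub>1 - U\<^sub>0" for y
      using 1(2)[of y] unfolding R_def x_def by blast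
    \<comment> \<open>The sequence \<open>x y\<close> lies in exactly one of
      \<open>U\<^sub>0\<close> and \<open>U\<^sub>1\<close>, and opposite to \<open>y\<close> if
      \<open>y\<close> is in one of the differences. Its odd and even halves would serve as
      \<open>e\<^sub>0\<close> and \<open>e\<^sub>1\<close>.\<close>
    have False
    proof (rule U_inseparable[OF continuous_comp[OF continuous_parts(2) x]
          continuous_comp[OF continuous_parts(1) x]])
      fix y
      note * = *[of y, unfolded U\<^sub>0_def U\<^sub>1_def]
      show "(\<lambda>n. x y (2 * n + 1)) \<in> \<rho> -` K \<longleftrightarrow> (\<lambda>n. x y (2 * n)) \<notin> \<rho> -` K"
        using * by blast
      show "(\<lambda>n. x y (2 * n + 1)) \<in> \<rho> -` K" if "y \<in> U\<^sub>0 - U\<^sub>1"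
        using * that[unfolded U\<^sub>0_def U\<^sub>1_def] by blast
      show "(\<lambda>n. x y (2 * n)) \<in> \<rho> -` K" if "y \<in> U\<^sub>1 - U\<^sub>0"
        using * that[unfolded U\<^sub>0_def U\<^sub>1_def] by blast
    qed
    then show thesis ..
  next
    case (2 h)
    show thesis
    proof (rule that[of h])
      show "continuous_on UNIV h" by (rule nonexpansive_imp_continuous) fact
      fix x
      note * = 2(2)[of "encode_graph x", unfolded R_def]
      show "h (encode_graph x) \<in> U\<^sub>0 - U\<^sub>1" if "x \<in> U\<^sub>0 - U\<^sub>1"
        using * that encode_graph_codes[of x] by (auto simp: decode_encode_graph)
      show "h (encode_graph x) \<in> U\<^sub>1 - U\<^sub>0" if "x \<in> U\<^sub>1 - U\<^sub>0"
        using * that encode_graph_codes[of x] by (auto simp: decode_encode_graph)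
    qed
  qed
qed

text \<open>The sets are the preimages of \<open>U\<^sub>0\<close> and \<open>U\<^sub>1\<close>
  under \<open>h \<circ> r\<close>. If some \<open>C\<close> separated their differences, reductions
  of \<open>C\<close> and its complement to \<open>K\<close>, restricted along
  \<open>i \<circ> encode_graph\<close>, would contradict \<open>U_inseparable\<close>.\<close>

lemma ex_inseparable_differences:
  fixes i :: "(nat \<Rightarrow> nat) \<Rightarrow> 'a"
  assumes i: "continuous_map euclidean Z i" and r: "continuous_map Z euclidean r"
    and ri: "\<And>c. (\<And>n. c n \<le> 1) \<Longrightarrow> r (i c) = c"
  obtains V\<^sub>0 V\<^sub>1 where "V\<^sub>0 \<in> \<Gamma>" "V\<^sub>1 \<in> \<Gamma>"
    "\<And>C. C \<in> ambiguous_class Z \<Gamma> \<Longrightarrow> V\<^sub>0 - V\<^sub>1 \<subseteq> C \<Longrightarrow> C \<inter> (V\<^sub>1 - V\<^sub>0) \<noteq> {}"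
proof -
  obtain h where h: "continuous_on UNIV h"
    "\<And>x. x \<in> U\<^sub>0 - U\<^sub>1 \<Longrightarrow> h (encode_graph x) \<in> U\<^sub>0 - U\<^sub>1"
    "\<And>x. x \<in> U\<^sub>1 - U\<^sub>0 \<Longrightarrow> h (encode_graph x) \<in> U\<^sub>1 - U\<^sub>0"
    using ex_cantor_reduction by blast
  define v where "v x = i (encode_graph x)" for x
  have rv: "r (v x) = encode_graph x" for x
    unfolding v_def by (rule ri, rule encode_graph_le)
  have v: "continuous_map euclidean Z v"
  proof -
    have "continuous_map euclidean euclidean encode_graph" using continuous_encode_graph by simp
    from continuous_map_compose[OF this i] show ?thesis unfolding v_def by (simp add: o_def)
  qed
  have vZ: "v x \<in> topspace Z" for x using v by (auto simp: continuous_map_def)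
  have hr: "continuous_map Z euclidean (\<lambda>z. f (h (r z)))" if "continuous_on UNIV f" for f :: "_ \<Rightarrow> nat \<Rightarrow> nat"
  proof -
    have "continuous_map euclidean euclidean (\<lambda>x. f (h x))" using continuous_comp[OF that h(1)] by simp
    from continuous_map_compose[OF r this] show ?thesis by (simp add: o_def)
  qed
  define V\<^sub>0 where "V\<^sub>0 = {z \<in> topspace Z. h (r z) \<in> U\<^sub>0}"
  define V\<^sub>1 where "V\<^sub>1 = {z \<in> topspace Z. h (r z) \<in> U\<^sub>1}"
  show thesis
  proof (rule that[of V\<^sub>0 V\<^sub>1])
    show "V\<^sub>0 \<in> \<Gamma>" "V\<^sub>1 \<in> \<Gamma>"
      using preimage_in_\<Gamma>[OF hr[OF continuous_parts(1)]] preimage_in_\<Gamma>[OF hr[OF continuous_parts(2)]]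
      unfolding V\<^sub>0_def V\<^sub>1_def U\<^sub>0_def U\<^sub>1_def by simp_all
    fix C assume C: "C \<in> ambiguous_class Z \<Gamma>" "V\<^sub>0 - V\<^sub>1 \<subseteq> C"
    have "C \<in> \<Gamma>" "topspace Z - C \<in> \<Gamma>"
      using C(1) by (simp_all add: ambiguous_class_def mem_dual_class[OF boldfaceD(1)[OF boldface_\<Gamma>]])
    then obtain a b where a: "continuous_map Z Z a" "C = preimage_in Z a K"
      and b: "continuous_map Z Z b" "topspace Z - C = preimage_in Z b K"
      unfolding \<Gamma>_eq by blast
    have ab: "v x \<in> C \<longleftrightarrow> a (v x) \<in> K" "v x \<notin> C \<longleftrightarrow> b (v x) \<in> K" for x
      using a(2) b(2) vZ unfolding preimage_in_def by blast+
    have mem: "\<iota> (f (v x)) \<in> \<rho> -` K \<longleftrightarrow> f (v x) \<in> K" if "continuous_map Z Z f" for f x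
      using continuous_map_image_subset_topspace[OF that] vZ \<rho>_\<iota> by (simp add: image_subset_iff)
    have cont: "continuous_on UNIV (\<lambda>x. \<iota> (f (v x)))" if "continuous_map Z Z f" for f
      using continuous_map_compose[OF continuous_map_compose[OF v that] cont_\<iota>] by (simp add: o_def)
    show "C \<inter> (V\<^sub>1 - V\<^sub>0) \<noteq> {}"
    proof
      assume disj: "C \<inter> (V\<^sub>1 - V\<^sub>0) = {}"
      show False
      proof (rule U_inseparable[OF cont[OF a(1)] cont[OF b(1)]], unfold mem[OF a(1)] mem[OF b(1)])
        fix x
        show "a (v x) \<in> K \<longleftrightarrow> b (v x) \<notin> K" using ab[of x] by blast
        show "a (v x) \<in> K" if "x \<in> U\<^sub>0 - U\<^sub>1"
        proof -
          have "v x \<in> V\<^sub>0 - V\<^sub>1" using h(2)[OF that] vZ[of x] by (simp add: V\<^sub>0_def V\<^sub>1_def rv)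
          then show ?thesis using C(2) ab(1) by blast
        qed
        show "b (v x) \<in> K" if "x \<in> U\<^sub>1 - U\<^sub>0"
        proof -
          have "v x \<in> V\<^sub>1 - V\<^sub>0" using h(3)[OF that] vZ[of x] by (simp add: V\<^sub>0_def V\<^sub>1_def rv)
          then show ?thesis using disj ab(2) by blast
        qed
      qed
    qed
  qed
qed

lemma not_both_separation_property:
  fixes i :: "(nat \<Rightarrow> nat) \<Rightarrow> 'a"
  assumes i: "continuous_map euclidean Z i" and r: "continuous_map Z euclidean r"
    and ri: "\<And>c. (\<And>n. c n \<le> 1) \<Longrightarrow> r (i c) = c"
  shows "\<not> (separation_property Z \<Gamma> \<and> separation_property Z (dual_class Z \<Gamma>))"
proof
  assume sep: "separation_property Z \<Gamma> \<and> separation_property Z (dual_class Z \<Gamma>)"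
  note \<Gamma>' = boldfaceD[OF boldface_\<Gamma>] and D' = boldfaceD[OF boldface_dual[OF boldface_\<Gamma>]]
  obtain V\<^sub>0 V\<^sub>1 where V: "V\<^sub>0 \<in> \<Gamma>" "V\<^sub>1 \<in> \<Gamma>"
    "\<And>C. C \<in> ambiguous_class Z \<Gamma> \<Longrightarrow> V\<^sub>0 - V\<^sub>1 \<subseteq> C \<Longrightarrow> C \<inter> (V\<^sub>1 - V\<^sub>0) \<noteq> {}"
    using ex_inseparable_differences[OF i r ri] by blast
  have top: "V\<^sub>0 \<subseteq> topspace Z" "V\<^sub>1 \<subseteq> topspace Z" using V(1,2) \<Gamma>'(1) by blast+
  have V': "topspace Z - V\<^sub>0 \<in> dual_class Z \<Gamma>" "topspace Z - V\<^sub>1 \<in> dual_class Z \<Gamma>"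
    using V(1,2) unfolding dual_class_def by blast+
  define P where "P = \<rho> -` V\<^sub>0 - \<rho> -` V\<^sub>1"
  define Q where "Q = \<rho> -` V\<^sub>1 - \<rho> -` V\<^sub>0"
  define N where "N = - (\<rho> -` V\<^sub>0 \<union> \<rho> -` V\<^sub>1)"
  have S: "P \<in> \<S>" "Q \<in> \<S>" "N \<in> \<S>"
    unfolding P_def Q_def N_def Diff_eq by (intro Int_in Compl_in Un_in \<Gamma>'(3) V)+
  have disj: "P \<inter> Q = {}" "N \<inter> (P \<union> Q) = {}" unfolding P_def Q_def N_def by blast+
  have PQ: "\<iota> z \<in> P \<longleftrightarrow> z \<in> V\<^sub>0 - V\<^sub>1" "\<iota> z \<in> Q \<longleftrightarrow> z \<in> V\<^sub>1 - V\<^sub>0" if "z \<in> topspace Z" for z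
    using \<rho>_\<iota>[OF that] by (auto simp: P_def Q_def)
  show False
  proof (rule flip_alternative[OF S disj])
    fix f
    assume f: "continuous_on UNIV f" "range f \<subseteq> P \<union> Q \<union> N" "f ` P \<subseteq> Q" "f ` Q \<subseteq> P"
    define \<phi> where "\<phi> z = \<rho> (f (\<iota> z))" for z
    have \<phi>: "continuous_map Z Z \<phi>" unfolding \<phi>_def by (intro continuous_map_retract f(1))
    have "\<not> (\<phi> z \<in> V\<^sub>0 \<and> \<phi> z \<in> V\<^sub>1)" for z
      using f(2) unfolding \<phi>_def P_def Q_def N_def by blast
    then have "preimage_in Z \<phi> V\<^sub>1 \<inter> preimage_in Z \<phi> V\<^sub>0 = {}" unfolding preimage_in_def by blast
    \<comment> \<open>The map exchanges the differences, so the preimages are separated in reversed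
      order; \<open>C\<close> then contains \<open>V\<^sub>0 - V\<^sub>1\<close>.\<close>
    then obtain C where C: "C \<in> ambiguous_class Z \<Gamma>" "preimage_in Z \<phi> V\<^sub>1 \<subseteq> C"
        "C \<subseteq> topspace Z - preimage_in Z \<phi> V\<^sub>0"
      using sep \<Gamma>'(2)[OF \<phi> V(1)] \<Gamma>'(2)[OF \<phi> V(2)] unfolding separation_property_def by meson
    have "\<phi> z \<in> V\<^sub>1" if "z \<in> V\<^sub>0 - V\<^sub>1" for z
      using f(3) PQ(1)[of z] that top(1) unfolding \<phi>_def Q_def by blast
    then have 1: "V\<^sub>0 - V\<^sub>1 \<subseteq> C" using C(2) top(1) unfolding preimage_in_def by blast
    have "\<phi> z \<in> V\<^sub>0" if "z \<in> V\<^sub>1 - V\<^sub>0" for z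
      using f(4) PQ(2)[of z] that top(2) unfolding \<phi>_def P_def by blast
    then have "C \<inter> (V\<^sub>1 - V\<^sub>0) = {}" using C(3) top(2) unfolding preimage_in_def by blast
    then show False using V(3)[OF C(1) 1] by blast
  next
    fix f
    assume f: "continuous_on UNIV f" "range f \<subseteq> - N" "f ` P \<subseteq> P" "f ` Q \<subseteq> Q"
    define \<phi> where "\<phi> z = \<rho> (f (\<iota> z))" for z
    have \<phi>: "continuous_map Z Z \<phi>" unfolding \<phi>_def by (intro continuous_map_retract f(1))
    have "\<phi> z \<in> V\<^sub>0 \<or> \<phi> z \<in> V\<^sub>1" for z
      using f(2) unfolding \<phi>_def N_def by blast
    \<comment> \<open>All values lie in \<open>V\<^sub>0 \<union> V\<^sub>1\<close>, so the
      complements have disjoint preimages; here the differences are preserved.\<close>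
    then have "preimage_in Z \<phi> (topspace Z - V\<^sub>1) \<inter> preimage_in Z \<phi> (topspace Z - V\<^sub>0) = {}"
      unfolding preimage_in_def by blast
    then obtain C where C: "C \<in> ambiguous_class Z (dual_class Z \<Gamma>)"
        "preimage_in Z \<phi> (topspace Z - V\<^sub>1) \<subseteq> C"
        "C \<subseteq> topspace Z - preimage_in Z \<phi> (topspace Z - V\<^sub>0)"
      using sep D'(2)[OF \<phi> V'(1)] D'(2)[OF \<phi> V'(2)] unfolding separation_property_def by meson
    have \<phi>_in: "\<phi> z \<in> topspace Z" for z unfolding \<phi>_def by (rule \<rho>_in)
    have "\<phi> z \<notin> V\<^sub>1" if "z \<in> V\<^sub>0 - V\<^sub>1" for z
      using f(3) PQ(1)[of z] that top(1) unfolding \<phi>_def P_def by blast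
    then have 1: "V\<^sub>0 - V\<^sub>1 \<subseteq> C" using C(2) top(1) \<phi>_in unfolding preimage_in_def by blast
    have "\<phi> z \<notin> V\<^sub>0" if "z \<in> V\<^sub>1 - V\<^sub>0" for z
      using f(4) PQ(2)[of z] that top(2) unfolding \<phi>_def Q_def by blast
    then have "C \<inter> (V\<^sub>1 - V\<^sub>0) = {}" using C(3) top(2) \<phi>_in unfolding preimage_in_def by blast
    then show False
      using V(3)[OF C(1)[unfolded ambiguous_class_dual[OF \<Gamma>'(1)]] 1] by blast
  qed
qed

end

section \<open>Zero-dimensional Polish spaces\<close>

text \<open>The Lindelof property: for each ball with centre in a countable dense set and radius
  \<open>1 / (k + 1)\<close> that fits into a member of the cover, one such member is kept.\<close>

lemma separable_imp_countable_subcover: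
  assumes M: "Metric_space M d" and "separable_space (Metric_space.mtopology M d)"
    and "\<And>V. V \<in> \<V> \<Longrightarrow> openin (Metric_space.mtopology M d) V" and "\<Union>\<V> = M"
  shows "\<exists>\<W>. countable \<W> \<and> \<W> \<subseteq> \<V> \<and> \<Union>\<W> = M"
proof -
  interpret Metric_space M d by (fact M)
  obtain C where C: "countable C" "C \<subseteq> M" "mtopology closure_of C = M"
    using assms(2) unfolding separable_space_def by auto
  define I where "I = {(c, k). c \<in> C \<and> (\<exists>V\<in>\<V>. mball c (inverse (real (Suc k))) \<subseteq> V)}"
  define W where "W = (\<lambda>(c, k). SOME V. V \<in> \<V> \<and> mball c (inverse (real (Suc k))) \<subseteq> V)"
  have W: "W (c, k) \<in> \<V> \<and> mball c (inverse (real (Suc k))) \<subseteq> W (c, k)" if "(c, k) \<in> I" for c k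
  proof -
    have "\<exists>V. V \<in> \<V> \<and> mball c (inverse (real (Suc k))) \<subseteq> V" using that unfolding I_def by blast
    from someI_ex[OF this] show ?thesis unfolding W_def by simp
  qed
  have "I \<subseteq> C \<times> UNIV" unfolding I_def by blast
  then have "countable (W ` I)"
    using C(1) by (meson countable_SIGMA countable_image countable_subset countableI_type)
  moreover have "W ` I \<subseteq> \<V>" using W by auto
  moreover have "M \<subseteq> \<Union>(W ` I)"
  proof
    fix x assume x: "x \<in> M"
    then obtain V where V: "V \<in> \<V>" "x \<in> V" using assms(4) by blast
    then obtain r where r: "r > 0" "mball x r \<subseteq> V"
      using assms(3)[OF V(1)] unfolding openin_mtopology by blast
    obtain k where k: "inverse (real (Suc k)) < r / 2" using reals_Archimedean[of "r / 2"] r(1) by auto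
    have "x \<in> mtopology closure_of C" using C(3) x by simp
    then have dense: "\<And>s. 0 < s \<Longrightarrow> \<exists>y\<in>C. y \<in> mball x s" unfolding metric_closure_of by simp
    have "\<exists>c\<in>C. c \<in> mball x (inverse (real (Suc k)))" by (rule dense) simp
    then obtain c where c: "c \<in> C" "c \<in> M" "d x c < inverse (real (Suc k))" by auto
    have "mball c (inverse (real (Suc k))) \<subseteq> mball x r"
    proof
      fix y assume y: "y \<in> mball c (inverse (real (Suc k)))"
      then have "d x y \<le> d x c + d c y" using triangle[OF x c(2)] by simp
      then show "y \<in> mball x r" using y c(3) k x by simp
    qed
    then have "(c, k) \<in> I" unfolding I_def using c(1) V(1) r(2) by blast
    moreover have "x \<in> mball c (inverse (real (Suc k)))" using c x by (simp add: commute)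
    ultimately show "x \<in> \<Union>(W ` I)" using W by blast
  qed
  ultimately show ?thesis using assms(4) by (intro exI[of _ "W ` I"]) blast
qed

text \<open>A countable cover by clopen sets inside balls of radius \<open>\<epsilon> / 2\<close> is
  made disjoint by taking least indices. The pieces are open because the earlier sets are
  closed.\<close>

lemma zero_dimensional_partition:
  assumes "zero_dimensional_space (Metric_space.mtopology M d)" and M: "Metric_space M d" and "\<epsilon> > 0"
  obtains p :: "'a \<Rightarrow> nat" where "\<And>k. openin (Metric_space.mtopology M d) {z \<in> M. p z = k}"
    "\<And>z z'. z \<in> M \<Longrightarrow> z' \<in> M \<Longrightarrow> p z = p z' \<Longrightarrow> d z z' < \<epsilon>"
proof -
  interpret Metric_space M d by (fact M)
  have "\<exists>\<B>. (\<forall>V\<in>\<B>. openin mtopology V \<and> closedin mtopology V) \<and>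
      (\<forall>U x. openin mtopology U \<and> x \<in> U \<longrightarrow> (\<exists>V\<in>\<B>. x \<in> V \<and> V \<subseteq> U))"
    and "M \<noteq> {}" and sep: "separable_space mtopology"
    using assms(1) unfolding zero_dimensional_space_def sep_metrizable_space_def by simp_all
  then obtain \<B> where \<B>1: "\<forall>V\<in>\<B>. openin mtopology V \<and> closedin mtopology V"
    and \<B>2: "\<forall>U x. openin mtopology U \<and> x \<in> U \<longrightarrow> (\<exists>V\<in>\<B>. x \<in> V \<and> V \<subseteq> U)"
    by (elim exE conjE)
  note \<B> = \<B>1[rule_format] \<B>2[rule_format, OF conjI]
  define \<V> where "\<V> = {V \<in> \<B>. \<exists>x\<in>M. V \<subseteq> mball x (\<epsilon> / 2)}"
  have \<V>: "\<Union>\<V> = M"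
  proof
    show "\<Union>\<V> \<subseteq> M" unfolding \<V>_def using mball_subset_mspace by blast
    show "M \<subseteq> \<Union>\<V>"
    proof
      fix x assume x: "x \<in> M"
      then have "x \<in> mball x (\<epsilon> / 2)" using assms(3) by simp
      then obtain V where "V \<in> \<B>" "x \<in> V" "V \<subseteq> mball x (\<epsilon> / 2)"
        using \<B>(2)[OF openin_mball] by blast
      then show "x \<in> \<Union>\<V>" unfolding \<V>_def using x by blast
    qed
  qed
  have opn: "openin mtopology V" if "V \<in> \<V>" for V using that \<B>(1) unfolding \<V>_def by blast
  obtain \<W> where \<W>: "countable \<W>" "\<W> \<subseteq> \<V>" "\<Union>\<W> = M"
    using separable_imp_countable_subcover[OF M sep opn \<V>] by blast
  have ne: "\<W> \<noteq> {}" using \<W>(3) \<open>M \<noteq> {}\<close> by blast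
  define V where "V = from_nat_into \<W>"
  have V: "V n \<in> \<V>" for n
    using from_nat_into[OF ne] \<W>(2) unfolding V_def by blast
  have V_cov: "\<exists>n. z \<in> V n" if "z \<in> M" for z
    using that \<W>(1,3) ne range_from_nat_into[OF ne \<W>(1)] unfolding V_def by blast
  define p where "p z = (LEAST n. z \<in> V n)" for z
  have p: "z \<in> V (p z)" if "z \<in> M" for z
    unfolding p_def using V_cov[OF that] by (rule LeastI_ex)
  show thesis
  proof (rule that[of p])
    fix k
    have "{z \<in> M. p z = k} = V k - (\<Union>n<k. V n)"
    proof (intro equalityI subsetI)
      fix z assume z: "z \<in> {z \<in> M. p z = k}"
      then have "z \<in> V k" using p by blast
      moreover have "z \<notin> V n" if "n < k" for n
        using z that not_less_Least unfolding p_def by blast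
      ultimately show "z \<in> V k - (\<Union>n<k. V n)" by blast
    next
      fix z assume z: "z \<in> V k - (\<Union>n<k. V n)"
      then have "z \<in> M" using V[of k] \<V> by blast
      moreover have "p z = k"
        unfolding p_def using z by (intro Least_equality) (auto simp: not_less[symmetric])
      ultimately show "z \<in> {z \<in> M. p z = k}" by blast
    qed
    moreover have "closedin mtopology (\<Union>n<k. V n)"
      using V \<B>(1) unfolding \<V>_def by (intro closedin_Union) auto
    moreover have "openin mtopology (V k)" using V \<B>(1) unfolding \<V>_def by blast
    ultimately show "openin mtopology {z \<in> M. p z = k}" by (simp add: openin_diff)
  next
    fix z z' assume z: "z \<in> M" "z' \<in> M" "p z = p z'"
    obtain x where x: "x \<in> M" "V (p z) \<subseteq> mball x (\<epsilon> / 2)" using V[of "p z"] unfolding \<V>_def by blast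
    have "d x z < \<epsilon> / 2" "d x z' < \<epsilon> / 2"
      using p[OF z(1)] p[OF z(2)] z(3) x(2) by auto
    moreover have "d z z' \<le> d x z + d x z'" using triangle[OF z(1) x(1) z(2)] by (simp add: commute)
    ultimately show "d z z' < \<epsilon>" by simp
  qed
qed

lemma continuous_map_into_sequencesI:
  fixes f :: "'a \<Rightarrow> nat \<Rightarrow> nat"
  assumes "\<And>n k. openin Z {z \<in> topspace Z. f z n = k}"
  shows "continuous_map Z euclidean f"
  unfolding continuous_map_def
proof (intro conjI allI impI)
  fix U :: "(nat \<Rightarrow> nat) set" assume U: "openin euclidean U"
  show "openin Z {x \<in> topspace Z. f x \<in> U}"
  proof (subst openin_subopen, intro ballI)
    fix x assume x: "x \<in> {x \<in> topspace Z. f x \<in> U}"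
    then obtain k where k: "\<forall>y. (\<forall>i<k. y i = f x i) \<longrightarrow> y \<in> U"
      using U open_imp_cylinder[of U "f x"] by auto
    define T where "T = topspace Z \<inter> (\<Inter>i\<in>{..<k}. {z \<in> topspace Z. f z i = f x i})"
    have "openin Z T" unfolding T_def by (cases "k = 0") (auto intro!: openin_Int openin_INT2 assms)
    moreover have "x \<in> T" using x unfolding T_def by blast
    moreover have "T \<subseteq> {x \<in> topspace Z. f x \<in> U}" unfolding T_def using k by auto
    ultimately show "\<exists>T. openin Z T \<and> x \<in> T \<and> T \<subseteq> {x \<in> topspace Z. f x \<in> U}" by blast
  qed
qed simp

text \<open>Digit \<open>n\<close> of \<open>\<iota> z\<close> names the piece containing
  \<open>z\<close> in a partition of mesh at most \<open>1 / (n + 1)\<close>. Completeness provides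
  a point for every sequence whose cylinders are all non-empty; other sequences go to a point of
  their last non-empty cylinder.\<close>

lemma zero_dimensional_polish_retract:
  assumes "polish_topology Z" "zero_dimensional_space Z"
  obtains \<iota> :: "'a \<Rightarrow> nat \<Rightarrow> nat" and \<rho> where "continuous_map Z euclidean \<iota>" "continuous_map euclidean Z \<rho>"
    "\<And>z. z \<in> topspace Z \<Longrightarrow> \<rho> (\<iota> z) = z"
proof -
  obtain M d where M: "Metric_space M d" "Metric_space.mcomplete M d" and Z: "Z = Metric_space.mtopology M d"
    using assms(1) unfolding polish_topology_def completely_metrizable_space_def by blast
  interpret Metric_space M d by (fact M)
  have ne: "M \<noteq> {}" using assms(2) Z unfolding zero_dimensional_space_def by simp
  have zd: "zero_dimensional_space mtopology" using assms(2) Z by simp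
  have "\<exists>p :: 'a \<Rightarrow> nat. (\<forall>k. openin mtopology {z \<in> M. p z = k}) \<and>
    (\<forall>z\<in>M. \<forall>z'\<in>M. p z = p z' \<longrightarrow> d z z' < inverse (Suc n))" for n
    using zero_dimensional_partition[OF zd M(1), of "inverse (Suc n)"] by (metis inverse_Suc)
  then obtain p :: "nat \<Rightarrow> 'a \<Rightarrow> nat" where p: "\<And>n k. openin mtopology {z \<in> M. p n z = k}"
    "\<And>n z z'. z \<in> M \<Longrightarrow> z' \<in> M \<Longrightarrow> p n z = p n z' \<Longrightarrow> d z z' < inverse (Suc n)"
    by metis
  define \<iota> where "\<iota> z n = p n z" for z n
  have cont_\<iota>: "continuous_map Z euclidean \<iota>"
    by (rule continuous_map_into_sequencesI) (use p(1) in \<open>simp add: \<iota>_def Z\<close>)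
  define cyl where "cyl n x = {z \<in> M. \<forall>i<n. p i z = x i}" for n and x :: "nat \<Rightarrow> nat"
  have cyl_cong: "cyl n y = cyl n x" if "\<forall>i<n. y i = x i" for n x y
    using that unfolding cyl_def by auto
  have limit: "\<exists>z. \<forall>n. z \<in> cyl n x" if ne: "\<And>n. cyl n x \<noteq> {}" for x
  proof -
    define \<sigma> where "\<sigma> n = (SOME z. z \<in> cyl n x)" for n
    have \<sigma>: "\<sigma> n \<in> cyl n x" for n using ne[of n] by (simp add: \<sigma>_def some_in_eq)
    have \<sigma>M: "\<sigma> n \<in> M" for n using \<sigma> unfolding cyl_def by blast
    have "MCauchy \<sigma>"
      unfolding MCauchy_def
    proof (intro conjI allI impI)
      fix \<epsilon> :: real assume "\<epsilon> > 0"
      then obtain N where N: "inverse (real (Suc N)) < \<epsilon>" using reals_Archimedean by blast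
      have "d (\<sigma> n) (\<sigma> n') < \<epsilon>" if "Suc N \<le> n" "Suc N \<le> n'" for n n'
      proof -
        have "p N (\<sigma> n) = p N (\<sigma> n')" using \<sigma>[of n] \<sigma>[of n'] that unfolding cyl_def by simp
        then show ?thesis using p(2)[OF \<sigma>M \<sigma>M] N by fastforce
      qed
      then show "\<exists>N. \<forall>n n'. N \<le> n \<longrightarrow> N \<le> n' \<longrightarrow> d (\<sigma> n) (\<sigma> n') < \<epsilon>" by blast
    qed (use \<sigma>M in blast)
    then obtain z where z: "limitin mtopology \<sigma> z sequentially" using M(2) unfolding mcomplete_def by blast
    then have zM: "z \<in> M" by (simp add: limitin_def)
    have "p i z = x i" for i
    proof -
      \<comment> \<open>The piece of \<open>z\<close> is open and hence contains almost all
        \<open>\<sigma> n\<close>, whose index is \<open>x i\<close> as soon as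
        \<open>n > i\<close>.\<close>
      have "\<forall>\<^sub>F n in sequentially. \<sigma> n \<in> {w \<in> M. p i w = p i z}"
        using z p(1)[of i "p i z"] zM unfolding limitin_def by blast
      then obtain N where N: "\<And>n. n \<ge> N \<Longrightarrow> \<sigma> n \<in> {w \<in> M. p i w = p i z}"
        unfolding eventually_sequentially by blast
      then have "p i (\<sigma> (max N (Suc i))) = p i z" by simp
      moreover have "p i (\<sigma> (max N (Suc i))) = x i"
        using \<sigma>[of "max N (Suc i)"] unfolding cyl_def by simp
      ultimately show ?thesis by simp
    qed
    then show ?thesis using zM unfolding cyl_def by blast
  qed
  \<comment> \<open>The first empty cylinder has positive index because \<open>cyl 0 x\<close> is
    \<open>M\<close>. The choice depends on the cylinder alone, so \<open>\<rho>\<close> is locally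
    constant off the range of \<open>\<iota>\<close>.\<close>
  define \<rho> where "\<rho> x = (if \<forall>n. cyl n x \<noteq> {} then SOME z. \<forall>n. z \<in> cyl n x
    else SOME z. z \<in> cyl ((LEAST n. cyl n x = {}) - 1) x)" for x
  have mono: "cyl n x \<subseteq> cyl k x" if "k \<le> n" for n k x
    using that unfolding cyl_def by auto
  have last: "(LEAST n. cyl n x = {}) \<noteq> 0 \<and> cyl (LEAST n. cyl n x = {}) x = {} \<and>
      \<rho> x \<in> cyl ((LEAST n. cyl n x = {}) - 1) x" if n: "cyl n x = {}" for n x
  proof -
    define m where "m = (LEAST n. cyl n x = {})"
    have m: "cyl m x = {}" unfolding m_def using n by (rule LeastI)
    have "cyl 0 x \<noteq> {}" using ne by (simp add: cyl_def)
    then have "m \<noteq> 0" using m by metis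
    then have "m - 1 < m" by simp
    then have "cyl (m - 1) x \<noteq> {}" unfolding m_def by (rule not_less_Least)
    moreover have "\<rho> x = (SOME z. z \<in> cyl (m - 1) x)" unfolding \<rho>_def m_def using n by auto
    ultimately show ?thesis using \<open>m \<noteq> 0\<close> m unfolding m_def by (simp add: some_in_eq)
  qed
  have \<rho>_cyl: "\<rho> x \<in> cyl k x" if k: "cyl k x \<noteq> {}" for x k
  proof (cases "\<forall>n. cyl n x \<noteq> {}")
    case True
    then have "\<exists>z. \<forall>n. z \<in> cyl n x" using limit by blast
    from someI_ex[OF this] show ?thesis using True unfolding \<rho>_def by simp
  next
    case False
    define m where "m = (LEAST n. cyl n x = {})"
    have m: "cyl m x = {}" "\<rho> x \<in> cyl (m - 1) x" using last False unfolding m_def by blast+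
    have "\<not> m \<le> k" using mono[of m k x] m(1) k by auto
    then have "k \<le> m - 1" by simp
    then show ?thesis using mono m(2) by blast
  qed
  have \<rho>_cong: "\<rho> y = \<rho> x" if n: "cyl n x = {}" and y: "\<forall>i<n. y i = x i" for n x y
  proof -
    define m where "m = (LEAST n. cyl n x = {})"
    have m: "cyl m x = {}" "m \<le> n"
      using last[OF n] Least_le[of "\<lambda>n. cyl n x = {}", OF n] unfolding m_def by blast+
    have eq: "cyl k y = cyl k x" if "k \<le> n" for k
      by (rule cyl_cong) (use y that in simp)
    have "(LEAST n. cyl n y = {}) = m"
    proof (rule Least_equality)
      show "cyl m y = {}" using m eq by simp
      show "m \<le> k" if k: "cyl k y = {}" for k
      proof (rule ccontr)
        assume "\<not> m \<le> k"
        then have "k < m" by simp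
        then have "cyl k x \<noteq> {}" unfolding m_def by (rule not_less_Least)
        moreover have "cyl k y = cyl k x" using \<open>k < m\<close> m(2) by (intro eq) simp
        ultimately show False using k by simp
      qed
    qed
    moreover have "cyl m y = {}" "cyl (m - 1) y = cyl (m - 1) x" using m eq by simp_all
    ultimately show ?thesis using m(1) unfolding \<rho>_def m_def[symmetric] by auto
  qed
  have \<rho>M: "\<rho> x \<in> M" for x
    using \<rho>_cyl[of 0 x] ne by (simp add: cyl_def)
  have cont_\<rho>: "continuous_map euclidean Z \<rho>"
    unfolding continuous_map_def
  proof (intro conjI allI impI)
    show "\<rho> \<in> topspace euclidean \<rightarrow> topspace Z" using \<rho>M by (simp add: Z)
    fix U assume "openin Z U"
    then have U: "openin mtopology U" using Z by simp
    have "\<exists>k. \<forall>y. (\<forall>i<k. y i = x i) \<longrightarrow> \<rho> y \<in> U" if x: "\<rho> x \<in> U" for x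
    proof (cases "\<forall>n. cyl n x \<noteq> {}")
      case True
      obtain \<epsilon> where \<epsilon>: "\<epsilon> > 0" "mball (\<rho> x) \<epsilon> \<subseteq> U"
        using U x unfolding openin_mtopology by blast
      then obtain N where N: "inverse (real (Suc N)) < \<epsilon>" using reals_Archimedean by blast
      have "\<rho> y \<in> U" if y: "\<forall>i<Suc N. y i = x i" for y
      proof -
        have "cyl (Suc N) y = cyl (Suc N) x" using y by (rule cyl_cong)
        then have "p N (\<rho> y) = x N" using \<rho>_cyl[of "Suc N" y] True by (simp add: cyl_def)
        moreover have "p N (\<rho> x) = x N" using \<rho>_cyl[of "Suc N" x] True by (simp add: cyl_def)
        ultimately have "p N (\<rho> x) = p N (\<rho> y)" by simp
        then have "d (\<rho> x) (\<rho> y) < \<epsilon>" using p(2)[OF \<rho>M \<rho>M] N by fastforce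
        then show ?thesis using \<epsilon>(2) \<rho>M by auto
      qed
      then show ?thesis by blast
    next
      case False
      then obtain n where n: "cyl n x = {}" by blast
      show ?thesis
      proof (intro exI[of _ n] allI impI)
        fix y assume "\<forall>i<n. y i = x i"
        then have "\<rho> y = \<rho> x" by (rule \<rho>_cong[OF n])
        then show "\<rho> y \<in> U" using x by simp
      qed
    qed
    then have "open (\<rho> -` U)"
      unfolding open_iff_cylinder vimage_eq by (intro ballI) (simp only: vimage_eq)
    then show "openin euclidean {x \<in> topspace euclidean. \<rho> x \<in> U}" by (simp add: vimage_def)
  qed
  have "\<rho> (\<iota> z) = z" if z: "z \<in> topspace Z" for z
  proof -
    have zM: "z \<in> M" using z Z by simp
    then have "z \<in> cyl n (\<iota> z)" for n by (simp add: cyl_def \<iota>_def)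
    then have all: "\<forall>n. cyl n (\<iota> z) \<noteq> {}" by blast
    have "d (\<rho> (\<iota> z)) z < inverse (Suc n)" for n
    proof (rule p(2)[OF \<rho>M zM])
      show "p n (\<rho> (\<iota> z)) = p n z" using \<rho>_cyl[of "Suc n" "\<iota> z"] all by (simp add: cyl_def \<iota>_def)
    qed
    then have "\<not> 0 < d (\<rho> (\<iota> z)) z" using reals_Archimedean by (metis less_asym)
    then show ?thesis using \<rho>M zM mdist_pos_less by blast
  qed
  with cont_\<iota> cont_\<rho> show thesis by (rule that)
qed

text \<open>A perfect set argument: words with uncountably many points of \<open>Z\<close> above
  them split into a Cantor scheme. The map \<open>i\<close> follows a branch, and \<open>r\<close>
  reads off the turns.\<close>

lemma uncountable_retract_cantor:
  fixes Z :: "'a topology" and \<iota> :: "'a \<Rightarrow> nat \<Rightarrow> nat" and \<rho> :: "(nat \<Rightarrow> nat) \<Rightarrow> 'a"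
  assumes \<iota>: "continuous_map Z euclidean \<iota>" and \<rho>: "continuous_map euclidean Z \<rho>"
    and \<rho>_\<iota>: "\<And>z. z \<in> topspace Z \<Longrightarrow> \<rho> (\<iota> z) = z"
    and unc: "uncountable (topspace Z)"
  obtains i r where "continuous_map euclidean Z i" "continuous_map Z euclidean r"
    "\<And>c :: nat \<Rightarrow> nat. (\<And>n. c n \<le> 1) \<Longrightarrow> r (i c) = c"
proof -
  define ext where "ext l y \<longleftrightarrow> (\<forall>i<length l. (y :: nat \<Rightarrow> nat) i = l ! i)" for l y
  define B where "B l = {z \<in> topspace Z. ext l (\<iota> z)}" for l
  \<comment> \<open>Outside \<open>E\<close> every cylinder around a point is uncountable, so long
    initial segments of two such points give a splitting.\<close>
  define E where "E = (\<Union>l\<in>{l. countable (B l)}. B l)"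
  have "countable E" unfolding E_def by (intro countable_UN) auto
  define e where "e l t u \<longleftrightarrow> uncountable (B t) \<and> uncountable (B u) \<and> length l < length t \<and> length l < length u \<and>
      (\<forall>y. ext t y \<or> ext u y \<longrightarrow> ext l y) \<and> (\<forall>y. \<not> (ext t y \<and> ext u y))" for l t u
  have "\<exists>t u. e l t u" if l: "uncountable (B l)" for l
  proof -
    have "uncountable (B l - E)" using l \<open>countable E\<close> by (rule uncountable_minus_countable)
    then have "infinite (B l - E)" using countable_finite by blast
    then obtain z z' where z: "z \<in> B l - E" "z' \<in> B l - E" "z \<noteq> z'"
      by (metis finite.emptyI finite.insertI insertI1 finite_subset subsetI singletonD insertE)
    then have "\<iota> z \<noteq> \<iota> z'" using \<rho>_\<iota> unfolding B_def by (metis (mono_tags, lifting) DiffE mem_Collect_eq)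
    then obtain j where j: "\<iota> z j \<noteq> \<iota> z' j" by blast
    define n where "n = Suc (max j (length l))"
    have pre: "uncountable (B (map (\<iota> w) [0..<n]))" "\<And>y. ext (map (\<iota> w) [0..<n]) y \<Longrightarrow> ext l y"
      if w: "w \<in> B l - E" for w
    proof -
      have "w \<in> B (map (\<iota> w) [0..<n])" using w unfolding B_def ext_def by simp
      then show "uncountable (B (map (\<iota> w) [0..<n]))" using w unfolding E_def by blast
      show "ext l y" if "ext (map (\<iota> w) [0..<n]) y" for y
        using that w unfolding B_def ext_def n_def by (simp del: upt_Suc)
    qed
    have "e l (map (\<iota> z) [0..<n]) (map (\<iota> z') [0..<n])"
      unfolding e_def
    proof (intro conjI allI impI)
      show "\<not> (ext (map (\<iota> z) [0..<n]) y \<and> ext (map (\<iota> z') [0..<n]) y)" for y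
      proof
        assume y: "ext (map (\<iota> z) [0..<n]) y \<and> ext (map (\<iota> z') [0..<n]) y"
        have "j < n" unfolding n_def by simp
        then have "y j = \<iota> z j" "y j = \<iota> z' j" using y unfolding ext_def by auto
        then show False using j by simp
      qed
    qed (use pre[OF z(1)] pre[OF z(2)] in \<open>auto simp: n_def\<close>)
    then show ?thesis by blast
  qed
  then obtain e\<^sub>0 e\<^sub>1 where "\<And>l. uncountable (B l) \<Longrightarrow> e l (e\<^sub>0 l) (e\<^sub>1 l)" by metis
  then have e: "\<And>l. uncountable (B l) \<Longrightarrow> uncountable (B (e\<^sub>0 l))" "\<And>l. uncountable (B l) \<Longrightarrow> uncountable (B (e\<^sub>1 l))"
    "\<And>l. uncountable (B l) \<Longrightarrow> length l < length (e\<^sub>0 l)" "\<And>l. uncountable (B l) \<Longrightarrow> length l < length (e\<^sub>1 l)"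
    "\<And>l y. uncountable (B l) \<Longrightarrow> ext (e\<^sub>0 l) y \<Longrightarrow> ext l y" "\<And>l y. uncountable (B l) \<Longrightarrow> ext (e\<^sub>1 l) y \<Longrightarrow> ext l y"
    "\<And>l y. uncountable (B l) \<Longrightarrow> ext (e\<^sub>0 l) y \<Longrightarrow> \<not> ext (e\<^sub>1 l) y"
    unfolding e_def by blast+
  define T where "T = foldl (\<lambda>t b. if b = (0::nat) then e\<^sub>0 t else e\<^sub>1 t) []"
  have T0: "T [] = []" and TS: "T (l @ [b]) = (if b = 0 then e\<^sub>0 (T l) else e\<^sub>1 (T l))" for l b
    by (simp_all add: T_def)
  have "B [] = topspace Z" by (simp add: B_def ext_def)
  then have T_unc: "uncountable (B (T l))" for l
    by (induction l rule: rev_induct) (use unc e(1,2) in \<open>auto simp: T0 TS\<close>)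
  have T_len: "length l \<le> length (T l)" for l
  proof (induction l rule: rev_induct)
    case (snoc b l)
    then show ?case using e(3,4)[OF T_unc[of l]] by (auto simp: TS)
  qed simp
  have T_ext: "ext (T l) y" if "ext (T (l @ [b])) y" for l b y
    using that e(5,6)[OF T_unc[of l]] by (auto simp: TS split: if_splits)
  define P where "P c n = T (map c [0..<n])" for c n
  have PS: "P c (Suc n) = (if c n = 0 then e\<^sub>0 (P c n) else e\<^sub>1 (P c n))" for c n
    by (simp add: P_def TS)
  have P_ext: "ext (P c m) y" if "ext (P c n) y" "m \<le> n" for c m n y
    using that(2,1) by (induction rule: dec_induct) (auto simp: P_def dest: T_ext)
  have P_len: "n \<le> length (P c n)" for c n using T_len[of "map c [0..<n]"] by (simp add: P_def)
  have "\<exists>z. z \<in> B (P c n)" for c n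
    using T_unc[of "map c [0..<n]"] unfolding P_def by (metis countable_empty ex_in_conv)
  then obtain w where w: "\<And>c n. w c n \<in> topspace Z" "\<And>c n. ext (P c n) (\<iota> (w c n))"
    unfolding B_def by (metis (mono_tags, lifting) mem_Collect_eq)
  \<comment> \<open>The word of stage \<open>n + 1\<close> has length at least \<open>n + 1\<close>,
    so it fixes digit \<open>n\<close>.\<close>
  define x where "x c n = P c (Suc n) ! n" for c n
  have x_eq: "\<iota> (w c n) j = x c j" if "j < n" for c n j
  proof -
    have "ext (P c (Suc j)) (\<iota> (w c n))" using P_ext[OF w(2)] that by simp
    then show ?thesis using P_len[of "Suc j" c] unfolding ext_def x_def by simp
  qed
  have x_ext: "ext (P c n) (x c)" for c n
    unfolding ext_def
  proof (intro allI impI)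
    fix j assume j: "j < length (P c n)"
    define m where "m = max n (Suc j)"
    have "ext (P c n) (\<iota> (w c m))" using P_ext[OF w(2)] m_def by simp
    then show "x c j = P c n ! j" using j x_eq[of j m c] unfolding ext_def m_def by simp
  qed
  have cont: "continuous_on UNIV (\<lambda>y. \<iota> (\<rho> y))"
    using continuous_map_compose[OF \<rho> \<iota>] by (simp add: o_def)
  \<comment> \<open>The points \<open>\<iota> (w c n)\<close> are fixed by
    \<open>\<iota> \<circ> \<rho>\<close> and converge to \<open>x c\<close>, so continuity makes
    \<open>x c\<close> a fixed point too.\<close>
  have \<iota>_\<rho>_x: "\<iota> (\<rho> (x c)) = x c" for c
  proof
    fix j
    have "open ((\<lambda>y. \<iota> (\<rho> y) j) -` {\<iota> (\<rho> (x c)) j})"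
      by (intro open_vimage continuous_on_product_then_coordinatewise[OF cont]) (simp add: open_discrete)
    then have "\<exists>k. \<forall>y. (\<forall>i<k. y i = x c i) \<longrightarrow> y \<in> (\<lambda>y. \<iota> (\<rho> y) j) -` {\<iota> (\<rho> (x c)) j}"
      by (rule open_imp_cylinder) simp
    then obtain k where k: "\<forall>y. (\<forall>i<k. y i = x c i) \<longrightarrow> \<iota> (\<rho> y) j = \<iota> (\<rho> (x c)) j"
      unfolding vimage_singleton_eq ..
    define m where "m = max k (Suc j)"
    have "\<forall>i<k. \<iota> (w c m) i = x c i" using x_eq[of _ m c] by (simp add: m_def)
    then have "\<iota> (\<rho> (\<iota> (w c m))) j = \<iota> (\<rho> (x c)) j" using k by blast
    then show "\<iota> (\<rho> (x c)) j = x c j" using \<rho>_\<iota>[OF w(1)] x_eq[of j m c] by (simp add: m_def)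
  qed
  have "continuous_on UNIV x"
  proof (rule continuous_on_sequencesI)
    fix c n
    show "\<exists>k. \<forall>c'. (\<forall>i<k. c' i = c i) \<longrightarrow> x c' n = x c n"
    proof (intro exI[of _ "Suc n"] allI impI)
      fix c' assume "\<forall>i<Suc n. c' i = c i"
      then have "map c' [0..<Suc n] = map c [0..<Suc n]" by simp
      then show "x c' n = x c n" unfolding x_def P_def by (rule arg_cong)
    qed
  qed
  then have cont_i: "continuous_map euclidean Z (\<lambda>c. \<rho> (x c))"
    using continuous_map_compose[OF _ \<rho>, of euclidean x] by (simp add: o_def)
  \<comment> \<open>Descending the scheme, \<open>r\<close> asks only whether \<open>y\<close>
    extends the word of the right-hand child; this makes sense for every sequence
    \<open>y\<close>.\<close>
  define F where "F y l = (if ext (e\<^sub>1 (T l)) y then 1 else 0 :: nat)" for y l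
  obtain r where r: "\<And>y n. r y n = F y (map (r y) [0..<n])"
    using ex_sequence_by_recursion[of "F _"] by metis
  have r_cong: "\<exists>k. \<forall>y'. (\<forall>i<k. y' i = y i) \<longrightarrow> map (r y') [0..<n] = map (r y) [0..<n]" for y n
  proof (induction n)
    case (Suc n)
    then obtain k where k: "\<forall>y'. (\<forall>i<k. y' i = y i) \<longrightarrow> map (r y') [0..<n] = map (r y) [0..<n]" by blast
    define t where "t = e\<^sub>1 (T (map (r y) [0..<n]))"
    show ?case
    proof (intro exI[of _ "max k (length t)"] allI impI)
      fix y' assume y': "\<forall>i<max k (length t). y' i = y i"
      then have "\<forall>i<k. y' i = y i" by simp
      then have eq: "map (r y') [0..<n] = map (r y) [0..<n]" using k by blast
      have "ext t y' \<longleftrightarrow> ext t y" using y' unfolding ext_def by simp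
      then have "F y' (map (r y') [0..<n]) = F y (map (r y) [0..<n])"
        unfolding eq F_def t_def by simp
      then have "r y' n = r y n" using r by metis
      then show "map (r y') [0..<Suc n] = map (r y) [0..<Suc n]" using eq by simp
    qed
  qed simp
  have "continuous_on UNIV r"
  proof (rule continuous_on_sequencesI)
    fix y n
    obtain k where k: "\<forall>y'. (\<forall>i<k. y' i = y i) \<longrightarrow> map (r y') [0..<Suc n] = map (r y) [0..<Suc n]"
      using r_cong by blast
    show "\<exists>k. \<forall>y'. (\<forall>i<k. y' i = y i) \<longrightarrow> r y' n = r y n"
    proof (intro exI[of _ k] allI impI)
      fix y' assume "\<forall>i<k. y' i = y i"
      then have "map (r y') [0..<Suc n] = map (r y) [0..<Suc n]" using k by blast
      then show "r y' n = r y n" by simp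
    qed
  qed
  then have cont_r: "continuous_map Z euclidean (\<lambda>z. r (\<iota> z))"
    using continuous_map_compose[OF \<iota>, of euclidean r] by (simp add: o_def)
  have rx: "r (x c) = c" if c: "\<And>n. c n \<le> 1" for c
  proof -
    have "map (r (x c)) [0..<n] = map c [0..<n]" for n
    proof (induction n)
      case (Suc n)
      have x_n: "ext (P c (Suc n)) (x c)" by (rule x_ext)
      have "r (x c) n = F (x c) (map c [0..<n])" using r Suc.IH by metis
      also have "\<dots> = (if ext (e\<^sub>1 (P c n)) (x c) then 1 else 0)" by (simp add: F_def P_def)
      also have "\<dots> = c n"
      proof (cases "c n = 0")
        case True
        then have "ext (e\<^sub>0 (P c n)) (x c)" using x_n by (simp add: PS)
        then have "\<not> ext (e\<^sub>1 (P c n)) (x c)" unfolding P_def by (rule e(7)[OF T_unc])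
        then show ?thesis using True by simp
      next
        case False
        then have "ext (e\<^sub>1 (P c n)) (x c)" "c n = 1" using x_n c[of n] by (simp_all add: PS)
        then show ?thesis by simp
      qed
      finally show ?case using Suc.IH by simp
    qed simp
    then have "map (r (x c)) [0..<Suc n] ! n = map c [0..<Suc n] ! n" for n by metis
    then have "r (x c) n = c n" for n by (simp del: upt_Suc)
    then show ?thesis by blast
  qed
  show thesis
    by (rule that[OF cont_i cont_r]) (simp add: \<iota>_\<rho>_x rx)
qed

section \<open>From nice pointclasses to sets of sequences\<close>

lemma sep_metrizable_baire_space: "sep_metrizable_space baire_space"
proof -
  obtain D :: "(nat \<Rightarrow> nat) set" where D: "countable D" "\<And>X. open X \<Longrightarrow> X \<noteq> {} \<Longrightarrow> \<exists>d\<in>D. d \<in> X"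
    using countable_dense_exists by (metis IntE ex_in_conv)
  have "closure D = UNIV"
  proof (rule ccontr)
    assume "closure D \<noteq> UNIV"
    then obtain d where "d \<in> D" "d \<in> - closure D" using D(2)[of "- closure D"] by auto
    then show False using closure_subset by blast
  qed
  then have "separable_space baire_space"
    unfolding separable_space_def using D(1) by (intro exI[of _ D]) simp
  moreover have "metrizable_space baire_space"
  proof -
    have "(euclidean :: nat topology) = discrete_topology UNIV"
      by (simp add: topology_eq open_openin[symmetric] open_discrete)
    then show ?thesis
      unfolding euclidean_product_topology[symmetric] metrizable_space_product_topology by simp
  qed
  ultimately show ?thesis
    unfolding sep_metrizable_space_def ..
qed

lemma determined_algebra_pointclass:
  assumes "nice_pointclass \<Sigma>" "Det (\<Sigma> baire_space)"
  shows "determined_algebra (\<Sigma> baire_space)"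
proof
  note sm = sep_metrizable_baire_space
  have alg: "algebra UNIV (\<Sigma> baire_space)"
    using assms(1) sm unfolding nice_pointclass_def by (metis topspace_euclidean)
  interpret algebra UNIV "\<Sigma> baire_space" by (fact alg)
  have borel: "borel_sets_of baire_space = sets borel"
    by (simp add: borel_sets_of_def borel_def)
  show "determined A" if "A \<in> \<Sigma> baire_space" for A
    using assms(2) that unfolding Det_def by blast
  show "A \<in> \<Sigma> baire_space" if "A \<in> sets borel" for A
    using assms(1) sm that borel unfolding nice_pointclass_def by blast
  show "- A \<in> \<Sigma> baire_space" if "A \<in> \<Sigma> baire_space" for A
    using compl_sets[OF that] by (simp add: Compl_eq_Diff_UNIV)
  show "A \<inter> B \<in> \<Sigma> baire_space" if "A \<in> \<Sigma> baire_space" "B \<in> \<Sigma> baire_space" for A B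
    using that by (rule Int)
  show "f -` A \<in> \<Sigma> baire_space" if f: "f \<in> borel_measurable borel" and A: "A \<in> \<Sigma> baire_space" for f A
  proof -
    have "f -` U \<in> sets borel" if "open U" for U
      using measurable_sets[OF f borel_open[OF that]] by simp
    then have "borel_map baire_space baire_space f"
      unfolding borel_map_def preimage_in_def borel by (simp add: vimage_def)
    then have "preimage_in baire_space f A \<in> \<Sigma> baire_space"
      using assms(1) sm A unfolding nice_pointclass_def by blast
    then show ?thesis by (simp add: preimage_in_def vimage_def)
  qed
qed

lemma vimage_pointclass_at:
  assumes "topological_pointclass \<Sigma>" "sep_metrizable_space Z" "A \<in> pointclass_at \<Sigma> Z"
    and \<rho>: "continuous_map baire_space Z \<rho>"
  shows "\<rho> -` A \<in> \<Sigma> baire_space"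
proof -
  obtain W :: small_space and h where h: "homeomorphic_map Z W h" "h ` A \<in> \<Sigma> W" and A: "A \<subseteq> topspace Z"
    using assms(3) unfolding pointclass_at_def by blast
  have "continuous_map baire_space W (h \<circ> \<rho>)"
    using \<rho> homeomorphic_imp_continuous_map[OF h(1)] by (rule continuous_map_compose)
  then have "preimage_in baire_space (h \<circ> \<rho>) (h ` A) \<in> \<Sigma> baire_space"
    using assms(1,2) h sep_metrizable_baire_space homeomorphic_map_sep_metrizable[OF h(1)]
    unfolding topological_pointclass_def by blast
  moreover have "preimage_in baire_space (h \<circ> \<rho>) (h ` A) = \<rho> -` A"
  proof -
    have "\<rho> x \<in> topspace Z" for x using \<rho> by (auto simp: continuous_map_def)
    then have "h (\<rho> x) \<in> h ` A \<longleftrightarrow> \<rho> x \<in> A" for x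
      using inj_on_image_mem_iff[OF homeomorphic_imp_injective_map[OF h(1)] _ A] by blast
    then show ?thesis unfolding preimage_in_def by auto
  qed
  ultimately show ?thesis by simp
qed

theorem theorem3p50:
  fixes \<Sigma> :: pointclass and Z :: "'a topology" and \<Gamma> :: "'a set set"
  assumes "nice_pointclass \<Sigma>"
    and "Det (\<Sigma> baire_space)"
    and "polish_topology Z" and "zero_dimensional_space Z" and "uncountable (topspace Z)"
    and "\<Gamma> \<in> NSD_in \<Sigma> Z"
  shows "(separation_property Z \<Gamma> \<and> \<not> separation_property Z (dual_class Z \<Gamma>)) \<or>
         (\<not> separation_property Z \<Gamma> \<and> separation_property Z (dual_class Z \<Gamma>))"
proof -
  obtain \<iota> :: "'a \<Rightarrow> nat \<Rightarrow> nat" and \<rho> where retr: "continuous_map Z euclidean \<iota>"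
    "continuous_map euclidean Z \<rho>" "\<And>z. z \<in> topspace Z \<Longrightarrow> \<rho> (\<iota> z) = z"
    using zero_dimensional_polish_retract[OF assms(3,4)] by blast
  obtain i r where ir: "continuous_map euclidean Z i" "continuous_map Z euclidean r"
    "\<And>c :: nat \<Rightarrow> nat. (\<And>n. c n \<le> 1) \<Longrightarrow> r (i c) = c"
    using uncountable_retract_cantor[OF retr assms(5)] by blast
  obtain K where K: "K \<subseteq> topspace Z" and \<Gamma>: "\<Gamma> = {preimage_in Z f K |f. continuous_map Z Z f}"
    and nsd: "\<not> selfdual Z \<Gamma>" and sub: "\<Gamma> \<subseteq> pointclass_at \<Sigma> Z"
    using assms(6) unfolding NSD_in_def NSD_def wadge_class_def by blast
  \<comment> \<open>Through the identity map the generating set belongs to its own class, hence to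
    the pointclass.\<close>
  have "preimage_in Z id K = K" using K unfolding preimage_in_def by auto
  then have "K \<in> \<Gamma>" unfolding \<Gamma> using continuous_map_id by blast
  then have "K \<in> pointclass_at \<Sigma> Z" using sub by blast
  moreover have "topological_pointclass \<Sigma>" using assms(1) by (simp add: nice_pointclass_def)
  moreover have "sep_metrizable_space Z" using assms(4) by (simp add: zero_dimensional_space_def)
  ultimately have K': "\<rho> -` K \<in> \<Sigma> baire_space"
    using vimage_pointclass_at retr(2) by metis
  interpret determined_algebra "\<Sigma> baire_space"
    by (rule determined_algebra_pointclass[OF assms(1,2)])
  interpret complete_set "\<Sigma> baire_space" Z \<iota> \<rho> K \<Gamma>
    by unfold_locales (fact retr K K' \<Gamma> nsd)+
  show ?thesis
    using separation_property_self_or_dual[OF boldface_\<Gamma>] not_both_separation_property[OF ir] by blast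
qed

end
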